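(* Let $\Gamma$ be a lattice in $\mathrm{SL}(2,\mathbb{R})$ and let $(\Gamma_n)$ be a Farber chain in $\Gamma$. Then $\mathrm{RG}(\Gamma,(\Gamma_n))>0$.
   Context: A chain in a finitely generated group $\Gamma$ is a sequence $\Gamma=\Gamma_0\ge\Gamma_1\ge\Gamma_2\ge\dots$ of subgroups of finite index. The coset tree $T=T(\Gamma,(\Gamma_n))$ is the rooted tree whose vertices of level $n$ are the right cosets $\Gamma_n g$ ($g\in\Gamma$), with an edge from $\Gamma_n g$ to $\Gamma_{n+1}g$ for all $n\ge 0$, $g\in\Gamma$. Its boundary $\partial T$ is the set of infinite rays starting from the root. For a vertex $t=\Gamma_n g$ of level $n$, the shadow $\mathrm{Sh}(t)\subseteq\partial T$ is the set of rays passing through $t$; the shadows form a base of the topology of $\partial T$, and $\mu$ is the Borel probability measure on $\partial T$ with $\mu(\mathrm{Sh}(t))=1/|\Gamma:\Gamma_n|$. $\Gamma$ acts on $T$ by right multiplication on cosets, and hence on $\partial T$ by measure-preserving homeomorphisms. The chain is Farber if this action on $\partial T$ is essentially free, i.e. $\mu$-almost every point has trivial stabilizer in $\Gamma$. $d(G)$ is the minimal number of generators of a group $G$. The rank gradient is $\mathrm{RG}(\Gamma,(\Gamma_n))=\lim_{n\to\infty}\frac{d(\Gamma_n)-1}{|\Gamma:\Gamma_n|}$ (the sequence is non-increasing). *)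

theory Defs
  imports
    "HOL-Probability.Probability_Measure"
    "HOL-Algebra.Coset"
    "HOL-Algebra.Generated_Groups"
begin

definition borel_algebra :: "'a topology \<Rightarrow> 'a measure" where
  "borel_algebra X = sigma (topspace X) {U. openin X U}"

lemma space_borel_algebra [simp]: "space (borel_algebra X) = topspace X"
  by (simp add: borel_algebra_def space_measure_of_conv)


section \<open>Lattices in SL(2,R)\<close>

definition SL2R :: "(real^2^2) monoid" where
  "SL2R = \<lparr>carrier = {A. det A = 1}, mult = (**), one = mat 1\<rparr>"

lemma SL2R_simps [simp]:
  "carrier SL2R = {A. det A = 1}"
  "A \<otimes>\<^bsub>SL2R\<^esub> B = A ** B"
  "\<one>\<^bsub>SL2R\<^esub> = mat 1"
  by (simp_all add: SL2R_def)

lemma group_SL2R: "group SL2R"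
proof (rule groupI)
  fix A assume A: "A \<in> carrier SL2R"
  then have "invertible A"
    by (simp add: invertible_det_nz)
  then obtain B where B: "B ** A = mat 1"
    by (auto simp: invertible_def)
  have "det B * det A = 1"
    using B det_mul[of B A] by simp
  with A B show "\<exists>B\<in>carrier SL2R. B \<otimes>\<^bsub>SL2R\<^esub> A = \<one>\<^bsub>SL2R\<^esub>"
    by auto
qed (auto simp: det_mul matrix_mul_assoc)

text \<open>
  The quotient topology on the space \<open>\<Lambda> \ SL(2,R)\<close> of right cosets. A set of cosets \<open>U\<close>
  has preimage \<open>\<Union>U\<close> in \<open>SL(2,R)\<close>.
\<close>
definition quotient_topology :: "(real^2^2) set \<Rightarrow> (real^2^2) set topology" where
  "quotient_topology \<Lambda> =
     topology (\<lambda>U. U \<subseteq> rcosets\<^bsub>SL2R\<^esub> \<Lambda> \<and> openin (top_of_set (carrier SL2R)) (\<Union>U))"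

lemma openin_quotient_topology:
  assumes "subgroup \<Lambda> SL2R"
  shows "openin (quotient_topology \<Lambda>) U \<longleftrightarrow>
           U \<subseteq> rcosets\<^bsub>SL2R\<^esub> \<Lambda> \<and> openin (top_of_set (carrier SL2R)) (\<Union>U)"
proof -
  let ?P = "\<lambda>U. U \<subseteq> rcosets\<^bsub>SL2R\<^esub> \<Lambda> \<and> openin (top_of_set (carrier SL2R)) (\<Union>U)"
  have inter: "\<Union>(U \<inter> V) = \<Union>U \<inter> \<Union>V"
    if "U \<subseteq> rcosets\<^bsub>SL2R\<^esub> \<Lambda>" "V \<subseteq> rcosets\<^bsub>SL2R\<^esub> \<Lambda>" for U V
  proof
    show "\<Union>U \<inter> \<Union>V \<subseteq> \<Union>(U \<inter> V)"
    proof
      fix A assume "A \<in> \<Union>U \<inter> \<Union>V"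
      then obtain C D where CD: "C \<in> U" "D \<in> V" "A \<in> C" "A \<in> D" by blast
      then have "C = D"
        using pairwiseD[OF group.rcos_disjoint[OF group_SL2R assms], of C D] that
        by (auto simp: disjnt_iff)
      with CD show "A \<in> \<Union>(U \<inter> V)" by blast
    qed
  qed blast
  have "istopology ?P"
    unfolding istopology_def
  proof (intro conjI allI impI)
    fix U V assume U: "?P U" and V: "?P V"
    then show "U \<inter> V \<subseteq> rcosets\<^bsub>SL2R\<^esub> \<Lambda>" by blast
    show "openin (top_of_set (carrier SL2R)) (\<Union>(U \<inter> V))"
      using U V inter[of U V] openin_Int[of _ "\<Union>U" "\<Union>V"] by simp
  next
    fix \<K> assume K: "\<forall>K\<in>\<K>. ?P K"
    then show "\<Union>\<K> \<subseteq> rcosets\<^bsub>SL2R\<^esub> \<Lambda>" by blast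
    have "openin (top_of_set (carrier SL2R)) (\<Union>(Union ` \<K>))"
      using K by (intro openin_Union) blast
    moreover have "\<Union>(\<Union>\<K>) = \<Union>(Union ` \<K>)" by blast
    ultimately show "openin (top_of_set (carrier SL2R)) (\<Union>(\<Union>\<K>))" by simp
  qed
  then show ?thesis
    by (simp add: quotient_topology_def topology_inverse')
qed

definition lattice_in_SL2R :: "(real^2^2) set \<Rightarrow> bool" where
  "lattice_in_SL2R \<Lambda> \<longleftrightarrow>
     subgroup \<Lambda> SL2R \<and> discrete \<Lambda> \<and>
     (\<exists>M. sets M = sets (borel_algebra (quotient_topology \<Lambda>)) \<and>
          finite_measure M \<and> emeasure M (space M) \<noteq> 0 \<and>
          (\<forall>g\<in>carrier SL2R. \<forall>A\<in>sets M.
             emeasure M ((\<lambda>C. C #>\<^bsub>SL2R\<^esub> g) ` A) = emeasure M A))"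


section \<open>Chains, coset trees and the Farber condition\<close>

definition subgroup_index :: "('a, 'b) monoid_scheme \<Rightarrow> 'a set \<Rightarrow> nat" where
  "subgroup_index G K = card (rcosets\<^bsub>G\<^esub> K)"

definition subgroup_chain :: "('a, 'b) monoid_scheme \<Rightarrow> (nat \<Rightarrow> 'a set) \<Rightarrow> bool" where
  "subgroup_chain G H \<longleftrightarrow>
     H 0 = carrier G \<and>
     (\<forall>n. subgroup (H n) G \<and> finite (rcosets\<^bsub>G\<^esub> H n) \<and> H (Suc n) \<subseteq> H n)"

text \<open>
  Vertices carry their level, since a coset of \<open>H n\<close> is also one of \<open>H (Suc n)\<close> if the two
  subgroups coincide. Edges are directed away from the root.
\<close>
definition tree_vertices ::
  "('a, 'b) monoid_scheme \<Rightarrow> (nat \<Rightarrow> 'a set) \<Rightarrow> (nat \<times> 'a set) set" where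
  "tree_vertices G H = {(n, H n #>\<^bsub>G\<^esub> g) | n g. g \<in> carrier G}"

definition tree_edges ::
  "('a, 'b) monoid_scheme \<Rightarrow> (nat \<Rightarrow> 'a set) \<Rightarrow> ((nat \<times> 'a set) \<times> (nat \<times> 'a set)) set" where
  "tree_edges G H =
     {((n, H n #>\<^bsub>G\<^esub> g), (Suc n, H (Suc n) #>\<^bsub>G\<^esub> g)) | n g. g \<in> carrier G}"

definition tree_boundary ::
  "('a, 'b) monoid_scheme \<Rightarrow> (nat \<Rightarrow> 'a set) \<Rightarrow> (nat \<Rightarrow> nat \<times> 'a set) set" where
  "tree_boundary G H = {x. x 0 = (0, H 0) \<and> (\<forall>n. (x n, x (Suc n)) \<in> tree_edges G H)}"

definition shadow ::
  "('a, 'b) monoid_scheme \<Rightarrow> (nat \<Rightarrow> 'a set) \<Rightarrow> nat \<times> 'a set \<Rightarrow> (nat \<Rightarrow> nat \<times> 'a set) set" where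
  "shadow G H t = {x \<in> tree_boundary G H. t \<in> range x}"

definition boundary_topology ::
  "('a, 'b) monoid_scheme \<Rightarrow> (nat \<Rightarrow> 'a set) \<Rightarrow> (nat \<Rightarrow> nat \<times> 'a set) topology" where
  "boundary_topology G H = topology_generated_by (shadow G H ` tree_vertices G H)"

definition boundary_measure ::
  "('a, 'b) monoid_scheme \<Rightarrow> (nat \<Rightarrow> 'a set) \<Rightarrow> (nat \<Rightarrow> nat \<times> 'a set) measure" where
  "boundary_measure G H =
     (THE \<mu>. sets \<mu> = sets (borel_algebra (boundary_topology G H)) \<and> prob_space \<mu> \<and>
        (\<forall>(n, C)\<in>tree_vertices G H.
           measure \<mu> (shadow G H (n, C)) = 1 / real (subgroup_index G (H n))))"

definition ray_action ::
  "('a, 'b) monoid_scheme \<Rightarrow> (nat \<Rightarrow> nat \<times> 'a set) \<Rightarrow> 'a \<Rightarrow> (nat \<Rightarrow> nat \<times> 'a set)" where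
  "ray_action G x g = (\<lambda>k. case x k of (n, C) \<Rightarrow> (n, C #>\<^bsub>G\<^esub> g))"

definition ray_stabilizer ::
  "('a, 'b) monoid_scheme \<Rightarrow> (nat \<Rightarrow> nat \<times> 'a set) \<Rightarrow> 'a set" where
  "ray_stabilizer G x = {g \<in> carrier G. ray_action G x g = x}"

definition farber_chain :: "('a, 'b) monoid_scheme \<Rightarrow> (nat \<Rightarrow> 'a set) \<Rightarrow> bool" where
  "farber_chain G H \<longleftrightarrow>
     subgroup_chain G H \<and> (AE x in boundary_measure G H. ray_stabilizer G x = {\<one>\<^bsub>G\<^esub>})"


section \<open>Rank gradient\<close>

text \<open>Equal to \<open>\<infinity>\<close>, the infimum of the empty set, if \<open>G\<close> is not finitely generated.\<close>
definition min_generators :: "('a, 'b) monoid_scheme \<Rightarrow> enat" where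
  "min_generators G = (INF S \<in> {S. finite S \<and> S \<subseteq> carrier G \<and> generate G S = carrier G}. enat (card S))"

definition rank_gradient :: "('a, 'b) monoid_scheme \<Rightarrow> (nat \<Rightarrow> 'a set) \<Rightarrow> ereal" where
  "rank_gradient G H =
     lim (\<lambda>n. (ereal_of_enat (min_generators (G\<lparr>carrier := H n\<rparr>)) - 1)
              / ereal (real (subgroup_index G (H n))))"

end

theory Submission
  imports Defs "HOL-Algebra.Multiplicative_Group" "HOL-Complex_Analysis.Complex_Analysis"
begin

text \<open>
  Schreier's bound \<open>d(L) - 1 \<le> |K : L| (d(K) - 1)\<close> makes the sequence that defines the rank gradient
  non-increasing, so its limit is its infimum. Hence the theorem follows from a constant \<open>N\<close>,
  depending on \<open>\<Gamma>\<close> only, such that \<open>|\<Gamma> : \<Lambda>| \<le> N (d(\<Lambda>) - 1)\<close> for every subgroup \<open>\<Lambda>\<close> of finite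
  index (\<open>lattice_index_bound\<close>).

  This bound compares the dimensions of two spaces, in the spirit of the Eichler--Shimura
  isomorphism. Let \<open>\<Gamma>\<close> act on the unit disc, and write \<open>a(\<gamma>)\<close>, \<open>b(\<gamma>)\<close> for the entries of the first row of
  \<open>\<gamma>\<close> in \<open>SU(1,1)\<close>. If \<open>n\<close> is large, each function \<open>x\<close> on \<open>\<Gamma>\<close> that is invariant on the right under \<open>\<Lambda>\<close>
  and on the left under the finite stabiliser of \<open>0\<close> gives a Poincare series
  \<open>\<Sum>\<gamma>. x(\<gamma>) j(\<gamma>, z) ^ -(n+2)\<close>, with \<open>j\<close> the factor of automorphy, an automorphic form for \<open>\<Lambda>\<close> of weight \<open>n+2\<close>. Its
  \<open>(n+1)\<close>-fold integral \<open>F\<close> is invariant under the action of \<open>\<Lambda>\<close> in weight \<open>-n\<close> only up to polynomials of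
  degree at most \<open>n\<close>. If \<open>\<Lambda>\<close> has \<open>d\<close> generators, invariance of \<open>F + p\<close>, with \<open>p\<close> another polynomial of
  degree at most \<open>n\<close>, amounts to \<open>d (n+1)\<close> linear equations for \<open>(x, p)\<close>. The unknown \<open>p\<close>
  contributes \<open>n+1\<close> dimensions, which replaces \<open>d\<close> by \<open>d - 1\<close>. So it suffices that no nonzero pair
  \<open>(x, p)\<close> gives an invariant function; then the number of double cosets of \<open>\<Lambda>\<close> and the stabiliser of \<open>0\<close>,
  the dimension of the space of admissible \<open>x\<close>, is at most \<open>(n+1) (d - 1)\<close>.

  Suppose that \<open>F + p\<close> is invariant. The weight is negative, so \<open>F + p\<close> is \<open>O(|a(\<gamma>)| ^ -n)\<close> at \<open>\<gamma> 0\<close>, and it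
  is continuous on the closed disc. The orbit of \<open>0\<close> accumulates at every point of the circle: the
  quotient has finite measure, so by Poincare recurrence, applied to the powers of a hyperbolic
  element that attracts to a given boundary point, \<open>\<Gamma>\<close> contains elements close to such powers
  (\<open>orbit_dense_at_boundary\<close>). Hence \<open>F + p\<close> vanishes on the circle, and on the disc by the maximum
  principle (\<open>invariant_integral_zero\<close>). Comparison of the coefficients of \<open>z ^ (n+1)\<close>, after a translation
  by each \<open>t \<in> \<Gamma>\<close>, yields \<open>\<Sum>\<gamma>. x(\<gamma> t) / cnj (a(\<gamma>)) ^ (n+2) = 0\<close> (\<open>coefficient_relations\<close>). Here
  \<open>|a(\<gamma>)| > 1\<close> unless \<open>\<gamma>\<close> fixes \<open>0\<close>, so if \<open>n\<close> is large, the terms with \<open>\<gamma> 0 = 0\<close> dominate and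
  \<open>x = 0\<close> (\<open>dominance_imp_zero\<close>). All series converge since a discrete subgroup has only polynomially
  many elements of bounded norm (\<open>summable_alpha_discrete\<close>).
\<close>

section \<open>Generators and index of subgroups\<close>

context group begin

text \<open>
  A finite set that is stable under an injection is mapped onto itself, so closure under the
  generators already implies closure under their inverses. This keeps the edges of the Schreier
  tree below directed forward.
\<close>
lemma rcosets_closed_under_generators:
  assumes K: "subgroup K G" and A: "A \<subseteq> rcosets K" "K \<in> A" "finite A"
    and S: "S \<subseteq> carrier G" "generate G S = carrier G"
    and closed: "\<And>c s. c \<in> A \<Longrightarrow> s \<in> S \<Longrightarrow> c #> s \<in> A"
  shows "A = rcosets K"
proof
  have sub: "c \<subseteq> carrier G" if "c \<in> A" for c
    using A(1) that rcosets_part_G[OF K] by blast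
  have step: "\<forall>c\<in>A. c #> g \<in> A" if "g \<in> generate G S" for g
    using that
  proof (induction rule: generate.induct)
    case one
    then show ?case using sub by simp
  next
    case (incl h)
    then show ?case using closed by blast
  next
    case (inv h)
    then have h: "h \<in> carrier G" using S by blast
    have inj: "inj_on (\<lambda>c. c #> h) A"
      by (rule inj_on_inverseI[of _ "\<lambda>c. c #> inv h"]) (simp add: coset_mult_assoc sub h)
    have "(\<lambda>c. c #> h) ` A = A"
      using closed inv by (intro endo_inj_surj A(3) inj) auto
    then have "\<exists>d\<in>A. c = d #> h" if "c \<in> A" for c
      using that by blast
    then show ?case
      by (metis sub h coset_mult_assoc inv_closed r_inv coset_mult_one)
  next
    case (eng h1 h2)
    then have "h1 \<in> carrier G" "h2 \<in> carrier G"
      using S(2) by auto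
    with eng show ?case by (metis sub coset_mult_assoc)
  qed
  show "rcosets K \<subseteq> A"
    using step A(2) S(2) unfolding RCOSETS_def by auto
qed (fact A(1))

text \<open>
  A spanning tree of the Schreier graph, grown one vertex at a time. The representatives \<open>\<tau>\<close> multiply
  exactly along the tree edges \<open>E\<close>, so that these edges give trivial Schreier generators.
\<close>
lemma schreier_tree:
  assumes K: "subgroup K G" and fin: "finite (rcosets K)"
    and S: "finite S" "S \<subseteq> carrier G" "generate G S = carrier G"
  obtains \<tau> E where "\<tau> K = \<one>" "\<And>c. c \<in> rcosets K \<Longrightarrow> \<tau> c \<in> c"
    "E \<subseteq> (rcosets K) \<times> S" "Suc (card E) = card (rcosets K)"
    "\<And>c s. (c, s) \<in> E \<Longrightarrow> \<tau> (c #> s) = \<tau> c \<otimes> s"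
proof -
  let ?P = "\<lambda>A \<tau> E. A \<subseteq> rcosets K \<and> K \<in> A \<and> \<tau> K = \<one> \<and> (\<forall>c\<in>A. \<tau> c \<in> c) \<and>
      E \<subseteq> A \<times> S \<and> Suc (card E) = card A \<and> (\<forall>(c,s)\<in>E. c #> s \<in> A \<and> \<tau> (c #> s) = \<tau> c \<otimes> s)"
  have grow: "Suc j \<le> card (rcosets K) \<Longrightarrow> \<exists>A \<tau> E. ?P A \<tau> E \<and> card A = Suc j" for j
  proof (induction j)
    case 0
    have "K \<in> rcosets K" by (rule subgroup.subgroup_in_rcosets[OF K is_group])
    then show ?case using subgroup.one_closed[OF K]
      by (intro exI[of _ "{K}"] exI[of _ "\<lambda>_. \<one>"] exI[of _ "{}"]) auto
  next
    case (Suc j)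
    then obtain A \<tau> E where P: "?P A \<tau> E" and cA: "card A = Suc j" by auto
    have finA: "finite A" using P fin finite_subset by blast
    have "A \<noteq> rcosets K" using Suc.prems cA by auto
    then obtain c s where cs: "c \<in> A" "s \<in> S" "c #> s \<notin> A"
      using rcosets_closed_under_generators[OF K _ _ finA S(2,3)] P by meson
    have "E \<subseteq> A \<times> S" using P by blast
    then have finE: "finite E" by (rule finite_subset) (simp add: finA S(1))
    have c: "c \<in> rcosets K" and s: "s \<in> carrier G" using P cs S by auto
    obtain g where g: "g \<in> carrier G" "c = K #> g" using c unfolding RCOSETS_def by blast
    have Kc: "K \<subseteq> carrier G" by (rule subgroup.subset[OF K])
    have new: "c #> s \<in> rcosets K"
      using g s Kc by (simp add: coset_mult_assoc rcosetsI)
    have ts: "\<tau> c \<otimes> s \<in> c #> s" using P cs(1) unfolding r_coset_def by blast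
    have neK: "c #> s \<noteq> K" using P cs by auto
    define \<tau>' where "\<tau>' = \<tau>(c #> s := \<tau> c \<otimes> s)"
    have old: "\<tau>' d = \<tau> d" if "d \<in> A" for d using that cs(3) by (auto simp: \<tau>'_def)
    have neE: "(c, s) \<notin> E" using P cs(3) by blast
    have "insert (c #> s) A \<subseteq> rcosets K" "K \<in> insert (c #> s) A" using P new by auto
    moreover have "\<tau>' K = \<one>" using P old by simp
    moreover have "\<forall>d\<in>insert (c #> s) A. \<tau>' d \<in> d" using P old ts by (simp add: \<tau>'_def)
    moreover have "insert (c, s) E \<subseteq> insert (c #> s) A \<times> S" using P cs by blast
    moreover have "Suc (card (insert (c, s) E)) = card (insert (c #> s) A)"
      using P cs(3) neE finA finE by simp
    moreover have "\<forall>(d,t)\<in>insert (c, s) E. d #> t \<in> insert (c #> s) A \<and> \<tau>' (d #> t) = \<tau>' d \<otimes> t"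
    proof (clarify, elim insertE)
      fix d t assume "(d, t) = (c, s)"
      then show "d #> t \<in> insert (c #> s) A \<and> \<tau>' (d #> t) = \<tau>' d \<otimes> t"
        using old[OF cs(1)] by (simp add: \<tau>'_def)
    next
      fix d t assume "(d, t) \<in> E"
      then have "d \<in> A" "d #> t \<in> A" "\<tau> (d #> t) = \<tau> d \<otimes> t" using P by blast+
      then show "d #> t \<in> insert (c #> s) A \<and> \<tau>' (d #> t) = \<tau>' d \<otimes> t" using old by simp
    qed
    ultimately have "?P (insert (c #> s) A) \<tau>' (insert (c, s) E)" by (intro conjI)
    moreover have "card (insert (c #> s) A) = Suc (Suc j)" using cs finA cA by simp
    ultimately have "?P (insert (c #> s) A) \<tau>' (insert (c, s) E) \<and> card (insert (c #> s) A) = Suc (Suc j)"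
      by (rule conjI)
    then show ?case
      by (rule exI[of _ "insert (c #> s) A", OF exI[of _ \<tau>', OF exI[of _ "insert (c, s) E"]]])
  qed
  have "K \<in> rcosets K" by (rule subgroup.subgroup_in_rcosets[OF K is_group])
  then have "card (rcosets K) > 0" using fin card_gt_0_iff by blast
  then obtain j where j: "card (rcosets K) = Suc j" by (cases "card (rcosets K)") simp_all
  have "\<exists>A \<tau> E. ?P A \<tau> E \<and> card A = Suc j" by (rule grow) (simp add: j)
  then obtain A \<tau> E where P: "?P A \<tau> E" and cA: "card A = Suc j"
    by (elim exE conjE) (rule that, intro conjI)
  have "A \<subseteq> rcosets K" using P by (elim conjE)
  then have A: "A = rcosets K" using card_subset_eq[OF fin] cA j by simp
  note P2 = conjunct2[OF conjunct2[OF P]]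
  note P4 = conjunct2[OF conjunct2[OF P2]]
  note P6 = conjunct2[OF conjunct2[OF P4]]
  show thesis
  proof (rule that)
    show "\<tau> K = \<one>" by (rule conjunct1[OF P2])
    show "\<tau> c \<in> c" if "c \<in> rcosets K" for c
      using conjunct1[OF conjunct2[OF P2]] that unfolding A by (rule bspec)
    show "E \<subseteq> (rcosets K) \<times> S" using conjunct1[OF P4] unfolding A .
    show "Suc (card E) = card (rcosets K)" using conjunct1[OF conjunct2[OF P4]] unfolding A .
    show "\<tau> (c #> s) = \<tau> c \<otimes> s" if "(c, s) \<in> E" for c s
      using bspec[OF P6 that] by simp
  qed
qed

text \<open>
  Only membership of the Schreier generators in \<open>generate G U\<close> is required, so that the trivial ones,
  which come from tree edges, can be left out of \<open>U\<close>.
\<close>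
lemma schreier_generators:
  assumes K: "subgroup K G" and S: "S \<subseteq> carrier G" "generate G S = carrier G"
    and \<tau>: "\<tau> K = \<one>" "\<And>c. c \<in> rcosets K \<Longrightarrow> \<tau> c \<in> c"
    and U: "U \<subseteq> K"
    and gen: "\<And>c s. c \<in> rcosets K \<Longrightarrow> s \<in> S \<Longrightarrow> \<tau> c \<otimes> s \<otimes> inv (\<tau> (c #> s)) \<in> generate G U"
  shows "generate G U = K"
proof
  have Kc: "K \<subseteq> carrier G" by (rule subgroup.subset[OF K])
  let ?U = "generate G U"
  have inv_cancel: "inv x \<otimes> (x \<otimes> y) = y" if "x \<in> carrier G" "y \<in> carrier G" for x y
    using that by (simp add: m_assoc[symmetric])
  have Usub: "subgroup ?U G" using generate_is_subgroup U Kc by blast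
  show "?U \<subseteq> K" by (rule generate_subgroup_incl[OF U K])
  have \<tau>c: "\<tau> c \<in> carrier G" if "c \<in> rcosets K" for c
    using \<tau>(2)[OF that] that rcosets_part_G[OF K] by blast
  have rc: "K #> h \<in> rcosets K" if "h \<in> carrier G" for h
    using that Kc by (rule rcosetsI[rotated])
  have step: "\<forall>h\<in>carrier G. h \<otimes> inv (\<tau> (K #> h)) \<in> ?U \<longrightarrow> h \<otimes> g \<otimes> inv (\<tau> (K #> (h \<otimes> g))) \<in> ?U"
    if "g \<in> generate G S" for g
    using that
  proof (induction rule: generate.induct)
    case one
    then show ?case by simp
  next
    case (incl s)
    show ?case
    proof (intro ballI impI)
      fix h assume h: "h \<in> carrier G" "h \<otimes> inv (\<tau> (K #> h)) \<in> ?U"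
      have s: "s \<in> carrier G" using incl S by blast
      have "\<tau> (K #> h) \<otimes> s \<otimes> inv (\<tau> (K #> (h \<otimes> s))) \<in> ?U"
        using gen[OF rc[OF h(1)] incl] h s Kc by (simp add: coset_mult_assoc)
      then have "(h \<otimes> inv (\<tau> (K #> h))) \<otimes> (\<tau> (K #> h) \<otimes> s \<otimes> inv (\<tau> (K #> (h \<otimes> s)))) \<in> ?U"
        using subgroup.m_closed[OF Usub] h by blast
      moreover have "(h \<otimes> inv (\<tau> (K #> h))) \<otimes> (\<tau> (K #> h) \<otimes> s \<otimes> inv (\<tau> (K #> (h \<otimes> s))))
          = h \<otimes> s \<otimes> inv (\<tau> (K #> (h \<otimes> s)))"
        using h s \<tau>c[OF rc[OF h(1)]] \<tau>c[OF rc[of "h \<otimes> s"]] by (simp add: m_assoc inv_cancel)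
      ultimately show "h \<otimes> s \<otimes> inv (\<tau> (K #> (h \<otimes> s))) \<in> ?U" by simp
    qed
  next
    case (inv s)
    show ?case
    proof (intro ballI impI)
      fix h assume h: "h \<in> carrier G" "h \<otimes> inv (\<tau> (K #> h)) \<in> ?U"
      have s: "s \<in> carrier G" using inv S by blast
      let ?h = "h \<otimes> inv s"
      have hs: "?h \<in> carrier G" "?h \<otimes> s = h" using h s by (auto simp: m_assoc)
      have "\<tau> (K #> ?h) \<otimes> s \<otimes> inv (\<tau> (K #> h)) \<in> ?U"
        using gen[OF rc[OF hs(1)] inv] hs s Kc by (simp add: coset_mult_assoc)
      then have "inv (\<tau> (K #> ?h) \<otimes> s \<otimes> inv (\<tau> (K #> h))) \<in> ?U"
        using subgroup.m_inv_closed[OF Usub] by blast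
      then have "(h \<otimes> inv (\<tau> (K #> h))) \<otimes> inv (\<tau> (K #> ?h) \<otimes> s \<otimes> inv (\<tau> (K #> h))) \<in> ?U"
        using subgroup.m_closed[OF Usub] h by blast
      moreover have "(h \<otimes> inv (\<tau> (K #> h))) \<otimes> inv (\<tau> (K #> ?h) \<otimes> s \<otimes> inv (\<tau> (K #> h)))
          = ?h \<otimes> inv (\<tau> (K #> ?h))"
        using h(1) s \<tau>c[OF rc[OF hs(1)]] \<tau>c[OF rc[OF h(1)]]
        by (simp add: m_assoc inv_mult_group inv_cancel)
      ultimately show "?h \<otimes> inv (\<tau> (K #> ?h)) \<in> ?U" by simp
    qed
  next
    case (eng g1 g2)
    have "g1 \<in> carrier G" "g2 \<in> carrier G" using eng S(2) by auto
    with eng show ?case by (metis m_assoc m_closed)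
  qed
  show "K \<subseteq> ?U"
  proof
    fix g assume g: "g \<in> K"
    then have gc: "g \<in> carrier G" using Kc by blast
    have "\<one> \<otimes> inv (\<tau> (K #> \<one>)) \<in> ?U"
      using \<tau>(1) Kc by (simp add: generate.one)
    then have "\<one> \<otimes> g \<otimes> inv (\<tau> (K #> (\<one> \<otimes> g))) \<in> ?U"
      using step[of g] gc S(2) by blast
    then show "g \<in> ?U"
      using \<tau>(1) gc g by (simp add: coset_join2 K)
  qed
qed

text \<open>
  Of the \<open>|G : K| card S\<close> Schreier generators, the \<open>|G : K| - 1\<close> on the edges of the tree are trivial. The
  inequality is \<open>card U - 1 \<le> |G : K| (card S - 1)\<close> without subtraction.
\<close>
lemma schreier_rank_bound:
  assumes K: "subgroup K G" and fin: "finite (rcosets K)"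
    and S: "finite S" "S \<subseteq> carrier G" "generate G S = carrier G"
  obtains U where "finite U" "U \<subseteq> K" "generate G U = K"
    "card U + card (rcosets K) \<le> card (rcosets K) * card S + 1"
proof -
  obtain \<tau> E where \<tau>: "\<tau> K = \<one>" "\<And>c. c \<in> rcosets K \<Longrightarrow> \<tau> c \<in> c"
    and E: "E \<subseteq> (rcosets K) \<times> S" "Suc (card E) = card (rcosets K)"
    "\<And>c s. (c, s) \<in> E \<Longrightarrow> \<tau> (c #> s) = \<tau> c \<otimes> s"
    using schreier_tree[OF K fin S] by blast
  define D where "D = (rcosets K) \<times> S - E"
  define u where "u = (\<lambda>(c,s). \<tau> c \<otimes> s \<otimes> inv (\<tau> (c #> s)))"
  have Kc: "K \<subseteq> carrier G" by (rule subgroup.subset[OF K])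
  have \<tau>c: "\<tau> c \<in> carrier G" if "c \<in> rcosets K" for c
    using \<tau>(2)[OF that] that rcosets_part_G[OF K] by blast
  have rs: "c #> s \<in> rcosets K" if "c \<in> rcosets K" "s \<in> S" for c s
    using that S(2) Kc unfolding RCOSETS_def by (auto simp: coset_mult_assoc subset_iff)
  have uK: "u (c, s) \<in> K" if c: "c \<in> rcosets K" and s: "s \<in> S" for c s
  proof -
    have sc: "s \<in> carrier G" using s S by blast
    obtain g where g: "g \<in> carrier G" "c = K #> g" using c unfolding RCOSETS_def by blast
    have cK: "c = K #> \<tau> c"
      using g \<tau>(2)[OF c] repr_independence[OF _ g(1) K] by auto
    have "\<tau> c \<otimes> s \<in> c #> s" using \<tau>(2)[OF c] unfolding r_coset_def by blast
    moreover have "c #> s = K #> \<tau> (c #> s)"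
      using \<tau>(2)[OF rs[OF c s]] repr_independence[OF _ _ K, of _ "g \<otimes> s"] g sc Kc
      by (auto simp: coset_mult_assoc)
    ultimately have "\<tau> c \<otimes> s \<in> K #> \<tau> (c #> s)" by simp
    then show ?thesis
      using subgroup.rcos_module_imp[OF K is_group \<tau>c[OF rs[OF c s]]] by (simp add: u_def)
  qed
  have finD: "finite D" and fE: "finite E" using finite_subset[OF E(1)] fin S(1) by (auto simp: D_def)
  have gen: "u (c, s) \<in> generate G (u ` D)" if "c \<in> rcosets K" "s \<in> S" for c s
  proof (cases "(c, s) \<in> E")
    case True
    then have "u (c, s) = \<one>" using E(3) \<tau>c[OF that(1)] S(2) that(2) by (auto simp: u_def)
    then show ?thesis using generate.one[of G] by simp
  next
    case False
    then show ?thesis using that by (intro generate.incl) (auto simp: D_def)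
  qed
  have UK: "u ` D \<subseteq> K" using uK by (auto simp: D_def)
  have G: "generate G (u ` D) = K"
    using schreier_generators[OF K S(2,3) \<tau> UK] gen by (auto simp: u_def)
  have "card D = card (rcosets K) * card S - card E"
    unfolding D_def using card_Diff_subset[OF fE E(1)] by (simp add: card_cartesian_product)
  moreover have "card E \<le> card (rcosets K) * card S"
    using card_mono[OF _ E(1)] fin S(1) by (simp add: card_cartesian_product)
  moreover have "card (u ` D) \<le> card D" by (rule card_image_le[OF finD])
  ultimately have "card (u ` D) + card (rcosets K) \<le> card (rcosets K) * card S + 1"
    using E(2) by linarith
  with that[of "u ` D"] finD UK G show thesis by blast
qed

lemma subgroup_index_mult:
  assumes K: "subgroup K G" and L: "subgroup L G" and LK: "L \<subseteq> K"
  shows "subgroup_index G L = subgroup_index G K * subgroup_index (G\<lparr>carrier := K\<rparr>) L"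
proof -
  have Kc: "K \<subseteq> carrier G" and Lc: "L \<subseteq> carrier G"
    using subgroup.subset K L by blast+
  define \<rho> where "\<rho> = (\<lambda>D. SOME g. g \<in> carrier G \<and> D = K #> g)"
  have \<rho>: "\<rho> D \<in> carrier G" "K #> \<rho> D = D" if "D \<in> rcosets K" for D
  proof -
    have "\<exists>g. g \<in> carrier G \<and> D = K #> g" using that unfolding RCOSETS_def by blast
    from someI_ex[OF this] show "\<rho> D \<in> carrier G" "K #> \<rho> D = D" unfolding \<rho>_def by auto
  qed
  have KL: "rcosets\<^bsub>G\<lparr>carrier := K\<rparr>\<^esub> L = {L #> k | k. k \<in> K}"
    unfolding RCOSETS_def by auto
  have eqL: "L #> x = L #> y \<longleftrightarrow> x \<otimes> inv y \<in> L" if "x \<in> carrier G" "y \<in> carrier G" for x y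
    using subgroup.rcos_module[OF L is_group that(2,1)] repr_independence[OF _ that(2) L, of x]
      rcos_self[OF that(1) L] by auto
  have eqK: "K #> x = K #> y \<longleftrightarrow> x \<otimes> inv y \<in> K" if "x \<in> carrier G" "y \<in> carrier G" for x y
    using subgroup.rcos_module[OF K is_group that(2,1)] repr_independence[OF _ that(2) K, of x]
      rcos_self[OF that(1) K] by auto
  let ?f = "\<lambda>(D, C). C #> \<rho> D"
  have "bij_betw ?f ((rcosets K) \<times> (rcosets\<^bsub>G\<lparr>carrier := K\<rparr>\<^esub> L)) (rcosets L)"
    unfolding bij_betw_def
  proof
    show "inj_on ?f ((rcosets K) \<times> (rcosets\<^bsub>G\<lparr>carrier := K\<rparr>\<^esub> L))"
    proof (rule inj_onI, clarify)
      fix D C D' C' assume D: "D \<in> rcosets K" "D' \<in> rcosets K"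
        and C: "C \<in> rcosets\<^bsub>G\<lparr>carrier := K\<rparr>\<^esub> L" "C' \<in> rcosets\<^bsub>G\<lparr>carrier := K\<rparr>\<^esub> L"
        and eq: "C #> \<rho> D = C' #> \<rho> D'"
      obtain k k' where k: "k \<in> K" "C = L #> k" "k' \<in> K" "C' = L #> k'"
        using C KL by auto
      have kc: "k \<in> carrier G" "k' \<in> carrier G" using k Kc by auto
      note \<rho>D = \<rho>[OF D(1)] \<rho>[OF D(2)]
      have "L #> (k \<otimes> \<rho> D) = L #> (k' \<otimes> \<rho> D')"
        using eq k kc \<rho>D Lc by (simp add: coset_mult_assoc)
      then have "k \<otimes> \<rho> D \<otimes> inv (k' \<otimes> \<rho> D') \<in> K"
        using eqL kc \<rho>D LK by auto
      then have "K #> (k \<otimes> \<rho> D) = K #> (k' \<otimes> \<rho> D')"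
        using eqK kc \<rho>D by auto
      moreover have "K #> k = K" "K #> k' = K"
        using coset_join2 k K kc by auto
      ultimately have DD: "D = D'"
        using kc \<rho>D Kc by (metis coset_mult_assoc)
      then have "C #> \<rho> D #> inv (\<rho> D) = C' #> \<rho> D #> inv (\<rho> D)" using eq by simp
      then have "C = C'"
        using k kc \<rho>D Lc r_coset_subset_G[OF Lc] by (simp add: coset_mult_assoc m_assoc)
      with DD show "D = D' \<and> C = C'" by simp
    qed
    show "?f ` ((rcosets K) \<times> (rcosets\<^bsub>G\<lparr>carrier := K\<rparr>\<^esub> L)) = rcosets L"
    proof
      show "?f ` ((rcosets K) \<times> (rcosets\<^bsub>G\<lparr>carrier := K\<rparr>\<^esub> L)) \<subseteq> rcosets L"
        using \<rho> Kc Lc KL by (auto simp: coset_mult_assoc subset_iff intro!: rcosetsI)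
      show "rcosets L \<subseteq> ?f ` ((rcosets K) \<times> (rcosets\<^bsub>G\<lparr>carrier := K\<rparr>\<^esub> L))"
      proof
        fix C assume "C \<in> rcosets L"
        then obtain g where g: "g \<in> carrier G" "C = L #> g" unfolding RCOSETS_def by blast
        define D where "D = K #> g"
        have D: "D \<in> rcosets K" using g Kc by (simp add: D_def rcosetsI)
        define k where "k = g \<otimes> inv (\<rho> D)"
        have k: "k \<in> K" using eqK[OF g(1) \<rho>(1)[OF D]] \<rho>(2)[OF D] by (simp add: k_def D_def)
        have "L #> k #> \<rho> D = C"
          using k g \<rho>(1)[OF D] Lc Kc by (auto simp: coset_mult_assoc k_def m_assoc)
        then show "C \<in> ?f ` ((rcosets K) \<times> (rcosets\<^bsub>G\<lparr>carrier := K\<rparr>\<^esub> L))"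
          using D k KL by (intro image_eqI[of _ _ "(D, L #> k)"]) auto
      qed
    qed
  qed
  then show ?thesis
    unfolding subgroup_index_def using bij_betw_same_card card_cartesian_product by metis
qed

end

section \<open>The action of SL(2,R) on the unit disc\<close>

text \<open>
  Conjugation with the Cayley transform maps \<open>SL(2,R)\<close> onto \<open>SU(1,1)\<close>; the first row of the image of \<open>A\<close>
  is \<open>(alpha A, beta A)\<close>, and the second one is \<open>(cnj (beta A), cnj (alpha A))\<close>.
\<close>
definition alpha :: "real^2^2 \<Rightarrow> complex" where
  "alpha A = Complex ((A$1$1 + A$2$2) / 2) ((A$1$2 - A$2$1) / 2)"

definition beta :: "real^2^2 \<Rightarrow> complex" where
  "beta A = Complex ((A$1$1 - A$2$2) / 2) (- (A$1$2 + A$2$1) / 2)"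

definition su11_matrix :: "complex \<Rightarrow> complex \<Rightarrow> real^2^2" where
  "su11_matrix a b = vector [vector [Re a + Re b, Im a - Im b], vector [- Im a - Im b, Re a - Re b]]"

lemma alpha_su11_matrix [simp]: "alpha (su11_matrix a b) = a"
  and beta_su11_matrix [simp]: "beta (su11_matrix a b) = b"
  by (simp_all add: alpha_def beta_def su11_matrix_def complex_eq_iff)

lemma det_eq_alpha_beta: "det A = (cmod (alpha A))\<^sup>2 - (cmod (beta A))\<^sup>2"
  unfolding det_2 alpha_def beta_def cmod_power2 by (simp add: power2_eq_square field_simps)

lemma matrix_mult_entry: "(A ** B) $ i $ j = A$i$1 * B$1$j + A$i$2 * B$2$j" for A B :: "real^2^2"
  by (simp add: matrix_matrix_mult_def sum_2)

lemma alpha_mult: "alpha (A ** B) = alpha A * alpha B + beta A * cnj (beta B)"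
  and beta_mult: "beta (A ** B) = alpha A * beta B + beta A * cnj (alpha B)"
  by (simp_all add: alpha_def beta_def complex_eq_iff matrix_mult_entry field_simps)

lemma alpha_one [simp]: "alpha (mat 1) = 1" and beta_one [simp]: "beta (mat 1) = 0"
  by (simp_all add: alpha_def beta_def mat_def complex_eq_iff)

lemma matrix_entries_alpha_beta:
  "A$1$1 = Re (alpha A) + Re (beta A)" "A$1$2 = Im (alpha A) - Im (beta A)"
  "A$2$1 = - Im (alpha A) - Im (beta A)" "A$2$2 = Re (alpha A) - Re (beta A)"
  by (simp_all add: alpha_def beta_def field_simps)

lemma alpha_beta_norm:
  assumes "det A = 1"
  shows "(cmod (alpha A))\<^sup>2 = 1 + (cmod (beta A))\<^sup>2" "cmod (beta A) < cmod (alpha A)"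
    "1 \<le> cmod (alpha A)" "alpha A \<noteq> 0"
    "(cmod (alpha A) - cmod (beta A)) * (2 * cmod (alpha A)) \<ge> 1"
proof -
  show sq: "(cmod (alpha A))\<^sup>2 = 1 + (cmod (beta A))\<^sup>2"
    using assms by (simp add: det_eq_alpha_beta)
  then have "(cmod (beta A))\<^sup>2 < (cmod (alpha A))\<^sup>2" by linarith
  then show lt: "cmod (beta A) < cmod (alpha A)" by (rule power2_less_imp_less) simp
  have "0 \<le> (cmod (beta A))\<^sup>2" by simp
  then have "1\<^sup>2 \<le> (cmod (alpha A))\<^sup>2" unfolding one_power2 using sq by linarith
  then show ge: "1 \<le> cmod (alpha A)" by (rule power2_le_imp_le) simp
  then show "alpha A \<noteq> 0" by auto
  have "1 = (cmod (alpha A) - cmod (beta A)) * (cmod (alpha A) + cmod (beta A))"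
    using sq by (simp add: power2_eq_square algebra_simps)
  also have "\<dots> \<le> (cmod (alpha A) - cmod (beta A)) * (2 * cmod (alpha A))"
    using lt by (intro mult_left_mono) auto
  finally show "(cmod (alpha A) - cmod (beta A)) * (2 * cmod (alpha A)) \<ge> 1" .
qed

lemma alpha_beta_SL2R_inv:
  assumes "det A = 1"
  shows "alpha (inv\<^bsub>SL2R\<^esub> A) = cnj (alpha A)" "beta (inv\<^bsub>SL2R\<^esub> A) = - beta A"
proof -
  let ?B = "su11_matrix (cnj (alpha A)) (- beta A)"
  have sq: "alpha A * cnj (alpha A) - beta A * cnj (beta A) = 1"
    using alpha_beta_norm(1)[OF assms] by (simp flip: complex_norm_square of_real_power)
  have eqI: "X = Y" if "alpha X = alpha Y" "beta X = beta Y" for X Y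
    using that by (simp add: vec_eq_iff forall_2 matrix_entries_alpha_beta)
  have "det ?B = 1" using assms by (simp add: det_eq_alpha_beta)
  moreover have "?B ** A = mat 1"
    by (rule eqI) (use sq in \<open>simp_all add: alpha_mult beta_mult mult.commute\<close>)
  ultimately have "inv\<^bsub>SL2R\<^esub> A = ?B"
    using group.inv_equality[OF group_SL2R, of ?B A] assms by simp
  then show "alpha (inv\<^bsub>SL2R\<^esub> A) = cnj (alpha A)" "beta (inv\<^bsub>SL2R\<^esub> A) = - beta A"
    by simp_all
qed

text \<open>
  The factor of automorphy \<open>j(A, z)\<close> of the Moebius action on the disc.
\<close>
definition aut :: "real^2^2 \<Rightarrow> complex \<Rightarrow> complex" where
  "aut A z = cnj (beta A) * z + cnj (alpha A)"

definition num :: "real^2^2 \<Rightarrow> complex \<Rightarrow> complex" where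
  "num A z = alpha A * z + beta A"

definition mob :: "real^2^2 \<Rightarrow> complex \<Rightarrow> complex" where
  "mob A z = num A z / aut A z"

text \<open>
  The usual slash operator of weight \<open>-n\<close>. It maps polynomials of degree at most \<open>n\<close> to such
  polynomials.
\<close>
definition slash :: "nat \<Rightarrow> real^2^2 \<Rightarrow> (complex \<Rightarrow> complex) \<Rightarrow> complex \<Rightarrow> complex" where
  "slash n A f z = aut A z ^ n * f (mob A z)"

text \<open>
  Since \<open>|a| - |b| = 1 / (|a| + |b|)\<close>, the factor of automorphy stays away from \<open>0\<close> up to the boundary
  of the disc. This makes the Eichler integrals continuous on the closed disc.
\<close>
lemma norm_aut_ge:
  assumes "det A = 1" "cmod z \<le> 1"
  shows "1 \<le> 2 * cmod (alpha A) * cmod (aut A z)"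
proof -
  have "cmod (alpha A) - cmod (beta A) \<le> cmod (alpha A) - cmod (beta A) * cmod z"
    using mult_left_le[OF assms(2), of "cmod (beta A)"] by simp
  also have "\<dots> \<le> cmod (aut A z)"
    using norm_triangle_ineq2[of "cnj (alpha A)" "- (cnj (beta A) * z)"]
    by (simp add: aut_def norm_mult add.commute)
  finally have "(cmod (alpha A) - cmod (beta A)) * (2 * cmod (alpha A)) \<le> cmod (aut A z) * (2 * cmod (alpha A))"
    by (rule mult_right_mono) simp
  then show ?thesis using alpha_beta_norm(5)[OF assms(1)] by (simp add: mult_ac)
qed

lemma aut_nonzero: "det A = 1 \<Longrightarrow> cmod z \<le> 1 \<Longrightarrow> aut A z \<noteq> 0"
  using norm_aut_ge[of A z] by auto

lemma norm_mob_le: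
  assumes "det A = 1" "cmod z \<le> 1"
  shows "cmod (mob A z) \<le> 1"
proof -
  have "(cmod (aut A z))\<^sup>2 - (cmod (num A z))\<^sup>2 = det A * (1 - (cmod z)\<^sup>2)"
    unfolding det_eq_alpha_beta aut_def num_def cmod_power2
    by (simp add: algebra_simps power2_eq_square)
  also have "\<dots> \<ge> 0" using assms by (simp add: power_le_one)
  finally have "(cmod (num A z))\<^sup>2 \<le> (cmod (aut A z))\<^sup>2" by simp
  then have "cmod (num A z) \<le> cmod (aut A z)" by (rule power2_le_imp_le) simp
  then show ?thesis
    using aut_nonzero[OF assms] by (simp add: mob_def norm_divide)
qed

lemma aut_mult: "aut B z \<noteq> 0 \<Longrightarrow> aut (A ** B) z = aut A (mob B z) * aut B z"
  by (simp add: aut_def mob_def num_def alpha_mult beta_mult field_simps)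

lemma num_mult: "aut B z \<noteq> 0 \<Longrightarrow> num (A ** B) z = num A (mob B z) * aut B z"
  by (simp add: aut_def mob_def num_def alpha_mult beta_mult field_simps)

lemma mob_mult: "aut B z \<noteq> 0 \<Longrightarrow> mob (A ** B) z = mob A (mob B z)"
  by (simp add: mob_def[of "A ** B"] aut_mult num_mult) (simp add: mob_def)

lemma slash_mult:
  assumes "det B = 1" "cmod z \<le> 1"
  shows "slash n (A ** B) f z = slash n B (slash n A f) z"
  using aut_nonzero[OF assms]
  by (simp add: slash_def aut_mult mob_mult power_mult_distrib mult_ac)

lemma slash_one [simp]: "slash n (mat 1) f z = f z"
  by (simp add: slash_def aut_def mob_def num_def)

section \<open>Eichler integrals of Poincare series\<close>

text \<open>
  Up to a constant factor that depends on \<open>n\<close> only, the \<open>(n+1)\<close>-fold integral from \<open>0\<close> of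
  \<open>aut A z ^ -(n+2)\<close>. If \<open>beta A \<noteq> 0\<close>, it is a multiple of the Taylor remainder of order \<open>n+1\<close> of
  \<open>1 / aut A z\<close> at \<open>0\<close>, whose \<open>(n+1)\<close>-st derivative is a multiple of \<open>aut A z ^ -(n+2)\<close>.
\<close>
definition eichler :: "nat \<Rightarrow> real^2^2 \<Rightarrow> complex \<Rightarrow> complex" where
  "eichler n A z = z ^ Suc n / (cnj (alpha A) ^ Suc n * aut A z)"

lemma norm_eichler_le:
  assumes "det A = 1" "cmod z \<le> 1"
  shows "cmod (1 / (cnj (alpha A) ^ Suc n * aut A z)) \<le> 2 * (1 / cmod (alpha A) ^ n)"
    "cmod (eichler n A z) \<le> 2 * (1 / cmod (alpha A) ^ n)"
proof -
  have a: "cmod (alpha A) > 0" and g: "cmod (aut A z) > 0"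
    using alpha_beta_norm(4)[OF assms(1)] aut_nonzero[OF assms] by auto
  have "1 / cmod (aut A z) \<le> 2 * cmod (alpha A)"
    using norm_aut_ge[OF assms] g by (simp add: field_simps)
  then have "1 / cmod (aut A z) / cmod (alpha A) ^ Suc n \<le> 2 * cmod (alpha A) / cmod (alpha A) ^ Suc n"
    by (rule divide_right_mono) simp
  then show 1: "cmod (1 / (cnj (alpha A) ^ Suc n * aut A z)) \<le> 2 * (1 / cmod (alpha A) ^ n)"
    using a by (simp add: norm_divide norm_mult norm_power field_simps)
  have "cmod (eichler n A z) = cmod z ^ Suc n * cmod (1 / (cnj (alpha A) ^ Suc n * aut A z))"
    by (simp add: eichler_def norm_divide norm_mult norm_power)
  also have "\<dots> \<le> 1 * cmod (1 / (cnj (alpha A) ^ Suc n * aut A z))"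
    using assms(2) by (intro mult_right_mono power_le_one) auto
  finally show "cmod (eichler n A z) \<le> 2 * (1 / cmod (alpha A) ^ n)"
    using 1 by simp
qed

text \<open>
  Bol's identity, in explicit form. Both \<open>slash n B (eichler n A)\<close> and \<open>eichler n (A ** B)\<close> have the
  form \<open>u ^ (n+1) / aut (A ** B) z\<close> with \<open>u\<close> linear in \<open>z\<close>, and the difference of the two linear functions is a
  multiple of \<open>aut (A ** B) z\<close>. So the difference of the powers is divisible by the denominator.
\<close>
lemma eichler_cocycle:
  assumes "det A = 1" "det B = 1" "cmod z \<le> 1"
  shows "slash n B (eichler n A) z = eichler n (A ** B) z +
    (\<Sum>i<Suc n. (beta B / (cnj (alpha A) * cnj (alpha (A ** B))) / cnj (alpha A) ^ i
        / cnj (alpha (A ** B)) ^ (n - i)) * (num B z ^ i * z ^ (n - i)))"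
proof -
  let ?a = "cnj (alpha A)" and ?c = "cnj (alpha (A ** B))" and ?j = "aut (A ** B) z"
  have det: "det (A ** B) = 1" using assms by (simp add: det_mul)
  have nz: "?a \<noteq> 0" "?c \<noteq> 0" "?j \<noteq> 0" "aut B z \<noteq> 0" "aut A (mob B z) \<noteq> 0"
    using alpha_beta_norm(4) aut_nonzero assms det norm_mob_le by auto
  have "1 = (cmod (alpha B))\<^sup>2 - (cmod (beta B))\<^sup>2" using alpha_beta_norm(1)[OF assms(2)] by simp
  then have sq: "alpha B * cnj (alpha B) = 1 + beta B * cnj (beta B)"
    using alpha_beta_norm(1)[OF assms(2)] by (simp flip: complex_norm_square of_real_power)
  have "?c * num B z - ?a * z = beta B * ?j"
  proof -
    have "?c * num B z - ?a * z - beta B * ?j = ?a * z * (alpha B * cnj (alpha B) - (1 + beta B * cnj (beta B)))"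
      by (simp add: num_def aut_def alpha_mult beta_mult algebra_simps)
    then show ?thesis using sq by simp
  qed
  then have diff: "num B z / ?a - z / ?c = beta B / (?a * ?c) * ?j"
    using nz by (simp add: field_simps)
  have "slash n B (eichler n A) z = (num B z / ?a) ^ Suc n / ?j"
    using nz by (simp add: slash_def eichler_def aut_mult mob_def[of B] power_divide field_simps)
  moreover have "eichler n (A ** B) z = (z / ?c) ^ Suc n / ?j"
    by (simp add: eichler_def power_divide)
  ultimately have "slash n B (eichler n A) z - eichler n (A ** B) z
      = ((num B z / ?a) ^ Suc n - (z / ?c) ^ Suc n) / ?j"
    by (simp add: diff_divide_distrib)
  also have "\<dots> = beta B / (?a * ?c) * (\<Sum>i<Suc n. (num B z / ?a) ^ i * (z / ?c) ^ (n - i))"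
    unfolding diff_power_eq_sum diff using nz by simp
  also have "\<dots> = (\<Sum>i<Suc n. (beta B / (?a * ?c) / ?a ^ i / ?c ^ (n - i)) * (num B z ^ i * z ^ (n - i)))"
    unfolding sum_distrib_left by (intro sum.cong) (auto simp: power_divide)
  finally show ?thesis by (simp add: algebra_simps)
qed

lemma infsum_finite_sum:
  fixes f :: "'i \<Rightarrow> 'a \<Rightarrow> complex"
  assumes "finite I" "\<And>i. i \<in> I \<Longrightarrow> f i summable_on A"
  shows "(\<lambda>x. \<Sum>i\<in>I. f i x) summable_on A" "(\<Sum>\<^sub>\<infinity>x\<in>A. \<Sum>i\<in>I. f i x) = (\<Sum>i\<in>I. infsum (f i) A)"
  using assms by (induction I rule: finite_induct) (simp_all add: summable_on_add infsum_add)

text \<open>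
  A polynomial of degree less than \<open>k\<close> that is \<open>O(z ^ k)\<close> at \<open>0\<close> vanishes. This separates the Eichler
  integrals, which are divisible by \<open>z ^ (n+1)\<close>, from their polynomial periods.
\<close>
lemma poly_divisible_by_power_imp_zero:
  fixes G :: "complex \<Rightarrow> complex"
  assumes "\<And>i. i \<ge> k \<Longrightarrow> poly.coeff q i = 0"
    and "\<And>z. z \<noteq> 0 \<Longrightarrow> cmod z \<le> 1 \<Longrightarrow> poly q z = z ^ k * G z"
    and "isCont G 0"
  shows "G 0 = 0"
  using assms(1,2)
proof (induction k arbitrary: q)
  have ev: "eventually (\<lambda>z. z \<noteq> 0 \<and> cmod z \<le> 1) (at (0::complex))"
    unfolding eventually_at by (auto intro!: exI[of _ 1])
  have G: "(G \<longlongrightarrow> G 0) (at 0)" using assms(3) by (simp add: isCont_def)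
  {
    case 0
    then have "q = 0" by (simp add: poly_eq_iff)
    have "eventually (\<lambda>z. G z = 0) (at 0)"
      by (rule eventually_mono[OF ev]) (use 0 \<open>q = 0\<close> in auto)
    then have "(G \<longlongrightarrow> 0) (at 0)" by (rule tendsto_eventually)
    then show ?case using G tendsto_unique trivial_limit_at by blast
  next
    case (Suc k)
    obtain a q1 where q: "q = pCons a q1" by (cases q)
    have "((\<lambda>z. z ^ Suc k * G z) \<longlongrightarrow> 0 ^ Suc k * G 0) (at 0)"
      by (intro tendsto_intros G)
    moreover have "eventually (\<lambda>z. z ^ Suc k * G z = poly q z) (at 0)"
      by (rule eventually_mono[OF ev]) (use Suc.prems(2) in auto)
    ultimately have "(poly q \<longlongrightarrow> 0) (at 0)"
      using tendsto_cong[of "\<lambda>z. z ^ Suc k * G z" "poly q" "at 0"] by simp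
    moreover have "(poly q \<longlongrightarrow> poly q 0) (at 0)"
      by (rule isContD[OF poly_isCont])
    ultimately have "poly q 0 = 0" using tendsto_unique trivial_limit_at by blast
    then have a: "a = 0" by (simp add: q)
    show ?case
    proof (rule Suc.IH[of q1])
      show "poly.coeff q1 i = 0" if "i \<ge> k" for i
        using Suc.prems(1)[of "Suc i"] that by (simp add: q)
      show "poly q1 z = z ^ k * G z" if "z \<noteq> 0" "cmod z \<le> 1" for z
        using Suc.prems(2)[OF that] that by (simp add: q a)
    qed
  }
qed

locale poincare_setting =
  fixes \<Gamma> :: "(real^2^2) set" and n :: nat
  assumes subgroup_\<Gamma>: "subgroup \<Gamma> SL2R"
    and summable_alpha: "(\<lambda>\<gamma>. 1 / cmod (alpha \<gamma>) ^ n) summable_on \<Gamma>"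
begin

lemma det_\<Gamma>: "\<gamma> \<in> \<Gamma> \<Longrightarrow> det \<gamma> = 1"
  using subgroup.mem_carrier[OF subgroup_\<Gamma>, of \<gamma>] by simp

lemma mult_\<Gamma>: "\<gamma> \<in> \<Gamma> \<Longrightarrow> \<delta> \<in> \<Gamma> \<Longrightarrow> \<gamma> ** \<delta> \<in> \<Gamma>"
  using subgroup.m_closed[OF subgroup_\<Gamma>] by simp

lemma inv_\<Gamma>: "\<gamma> \<in> \<Gamma> \<Longrightarrow> inv\<^bsub>SL2R\<^esub> \<gamma> \<in> \<Gamma>"
  using subgroup.m_inv_closed[OF subgroup_\<Gamma>] by simp

lemma one_\<Gamma>: "mat 1 \<in> \<Gamma>"
  using subgroup.one_closed[OF subgroup_\<Gamma>] by simp

lemma mult_inv_cancel: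
  assumes "\<delta> \<in> \<Gamma>"
  shows "\<gamma> ** \<delta> ** inv\<^bsub>SL2R\<^esub> \<delta> = \<gamma>" "\<gamma> ** inv\<^bsub>SL2R\<^esub> \<delta> ** \<delta> = \<gamma>"
  using group.r_inv[OF group_SL2R, of \<delta>] group.l_inv[OF group_SL2R, of \<delta>] det_\<Gamma>[OF assms]
  by (simp_all add: matrix_mul_assoc[symmetric])

definition eichler_series :: "(real^2^2 \<Rightarrow> complex) \<Rightarrow> complex \<Rightarrow> complex" where
  "eichler_series x z = (\<Sum>\<^sub>\<infinity>\<gamma>\<in>\<Gamma>. x \<gamma> * eichler n \<gamma> z)"

text \<open>
  The Eichler integral divided by \<open>z ^ (n+1)\<close>. Its value at \<open>0\<close> is the leading coefficient of the integral.
\<close>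
definition eichler_series_quot :: "(real^2^2 \<Rightarrow> complex) \<Rightarrow> complex \<Rightarrow> complex" where
  "eichler_series_quot x z = (\<Sum>\<^sub>\<infinity>\<gamma>\<in>\<Gamma>. x \<gamma> * (1 / (cnj (alpha \<gamma>) ^ Suc n * aut \<gamma> z)))"

definition bounded_coeffs :: "(real^2^2 \<Rightarrow> complex) \<Rightarrow> bool" where
  "bounded_coeffs x \<longleftrightarrow> (\<exists>B. \<forall>\<gamma>\<in>\<Gamma>. cmod (x \<gamma>) \<le> B)"

lemma bounded_coeffsE:
  assumes "bounded_coeffs x"
  obtains B where "B \<ge> 0" "\<And>\<gamma>. \<gamma> \<in> \<Gamma> \<Longrightarrow> cmod (x \<gamma>) \<le> B"
  using assms one_\<Gamma> unfolding bounded_coeffs_def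
  by (meson norm_ge_zero order_trans)

lemma bounded_coeffs_translate:
  assumes "bounded_coeffs x" "\<delta> \<in> \<Gamma>"
  shows "bounded_coeffs (\<lambda>\<gamma>. x (\<gamma> ** \<delta>))"
  using assms mult_\<Gamma> unfolding bounded_coeffs_def by blast

lemma eichler_series_eq_quot: "eichler_series x z = z ^ Suc n * eichler_series_quot x z"
  unfolding eichler_series_def eichler_series_quot_def infsum_cmult_right'[symmetric]
  by (intro infsum_cong) (simp add: eichler_def)

lemma summable_bounded_coeffs:
  assumes "bounded_coeffs x" "\<And>\<gamma>. \<gamma> \<in> \<Gamma> \<Longrightarrow> cmod (h \<gamma>) \<le> C * (1 / cmod (alpha \<gamma>) ^ n)"
  shows "(\<lambda>\<gamma>. x \<gamma> * h \<gamma>) summable_on \<Gamma>"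
proof -
  obtain B where B: "B \<ge> 0" "\<And>\<gamma>. \<gamma> \<in> \<Gamma> \<Longrightarrow> cmod (x \<gamma>) \<le> B"
    using bounded_coeffsE[OF assms(1)] by blast
  have "(\<lambda>\<gamma>. (B * C) * (1 / cmod (alpha \<gamma>) ^ n)) summable_on \<Gamma>"
    by (intro summable_on_cmult_right summable_alpha)
  then have "(\<lambda>\<gamma>. norm (x \<gamma> * h \<gamma>)) summable_on \<Gamma>"
  proof (rule Infinite_Sum.abs_summable_on_comparison_test')
    fix \<gamma> assume g: "\<gamma> \<in> \<Gamma>"
    show "cmod (x \<gamma> * h \<gamma>) \<le> (B * C) * (1 / cmod (alpha \<gamma>) ^ n)"
      unfolding norm_mult mult.assoc by (intro mult_mono B assms g) auto
  qed
  then show ?thesis by (rule abs_summable_summable)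
qed

lemma summable_eichler_series:
  assumes "bounded_coeffs x" "cmod z \<le> 1"
  shows "(\<lambda>\<gamma>. x \<gamma> * eichler n \<gamma> z) summable_on \<Gamma>"
  using assms(1) norm_eichler_le(2)[OF det_\<Gamma> assms(2)] by (rule summable_bounded_coeffs)

lemma regular_series:
  assumes x: "bounded_coeffs x"
    and h: "\<And>\<gamma> z. \<gamma> \<in> \<Gamma> \<Longrightarrow> cmod z \<le> 1 \<Longrightarrow> cmod (h \<gamma> z) \<le> 2 * (1 / cmod (alpha \<gamma>) ^ n)"
    and cont: "\<And>\<gamma>. \<gamma> \<in> \<Gamma> \<Longrightarrow> continuous_on (cball 0 1) (h \<gamma>)"
    and hol: "\<And>\<gamma>. \<gamma> \<in> \<Gamma> \<Longrightarrow> h \<gamma> holomorphic_on ball 0 1"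
  shows "continuous_on (cball 0 1) (\<lambda>z. \<Sum>\<^sub>\<infinity>\<gamma>\<in>\<Gamma>. x \<gamma> * h \<gamma> z)"
    "(\<lambda>z. \<Sum>\<^sub>\<infinity>\<gamma>\<in>\<Gamma>. x \<gamma> * h \<gamma> z) holomorphic_on ball 0 1"
proof -
  obtain B where B: "B \<ge> 0" "\<And>\<gamma>. \<gamma> \<in> \<Gamma> \<Longrightarrow> cmod (x \<gamma>) \<le> B"
    using bounded_coeffsE[OF x] by blast
  have ul: "uniform_limit (cball 0 1) (\<lambda>X z. \<Sum>\<gamma>\<in>X. x \<gamma> * h \<gamma> z)
      (\<lambda>z. \<Sum>\<^sub>\<infinity>\<gamma>\<in>\<Gamma>. x \<gamma> * h \<gamma> z) (finite_subsets_at_top \<Gamma>)"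
  proof (rule Weierstrass_m_test_general)
    show "(\<lambda>\<gamma>. (B * 2) * (1 / cmod (alpha \<gamma>) ^ n)) summable_on \<Gamma>"
      by (intro summable_on_cmult_right summable_alpha)
    fix \<gamma> z assume "\<gamma> \<in> \<Gamma>" "z \<in> cball (0::complex) 1"
    then show "cmod (x \<gamma> * h \<gamma> z) \<le> (B * 2) * (1 / cmod (alpha \<gamma>) ^ n)"
      unfolding norm_mult mult.assoc by (intro mult_mono B h) auto
  qed
  have ev: "\<forall>\<^sub>F X in finite_subsets_at_top \<Gamma>. continuous_on (cball 0 1) (\<lambda>z. \<Sum>\<gamma>\<in>X. x \<gamma> * h \<gamma> z)
      \<and> (\<lambda>z. \<Sum>\<gamma>\<in>X. x \<gamma> * h \<gamma> z) holomorphic_on ball 0 1"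
    by (rule eventually_finite_subsets_at_top_weakI)
      (intro conjI continuous_intros holomorphic_intros cont hol; blast)
  show "continuous_on (cball 0 1) (\<lambda>z. \<Sum>\<^sub>\<infinity>\<gamma>\<in>\<Gamma>. x \<gamma> * h \<gamma> z)"
    "(\<lambda>z. \<Sum>\<^sub>\<infinity>\<gamma>\<in>\<Gamma>. x \<gamma> * h \<gamma> z) holomorphic_on ball 0 1"
    using holomorphic_uniform_limit[OF ev ul] by auto
qed

lemma eichler_series_regular:
  assumes "bounded_coeffs x"
  shows "continuous_on (cball 0 1) (eichler_series x)" "eichler_series x holomorphic_on ball 0 1"
    "continuous_on (cball 0 1) (eichler_series_quot x)"
proof -
  have nz: "aut \<gamma> z \<noteq> 0" "alpha \<gamma> \<noteq> 0" if "\<gamma> \<in> \<Gamma>" "cmod z \<le> 1" for \<gamma> z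
    using aut_nonzero alpha_beta_norm(4) det_\<Gamma> that by auto
  note [simp] = nz
  have 1: "continuous_on (cball 0 1) (eichler n \<gamma>)" "eichler n \<gamma> holomorphic_on ball 0 1"
    "continuous_on (cball 0 1) (\<lambda>z. 1 / (cnj (alpha \<gamma>) ^ Suc n * aut \<gamma> z))"
    "(\<lambda>z. 1 / (cnj (alpha \<gamma>) ^ Suc n * aut \<gamma> z)) holomorphic_on ball 0 1" if "\<gamma> \<in> \<Gamma>" for \<gamma>
    unfolding eichler_def[abs_def] using nz[OF that]
    by (auto simp: aut_def intro!: continuous_intros holomorphic_intros)
  show "continuous_on (cball 0 1) (eichler_series x)" "eichler_series x holomorphic_on ball 0 1"
    unfolding eichler_series_def[abs_def] using regular_series[OF assms norm_eichler_le(2)[OF det_\<Gamma>] 1(1,2)] by auto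
  show "continuous_on (cball 0 1) (eichler_series_quot x)"
    unfolding eichler_series_quot_def[abs_def] using regular_series(1)[OF assms norm_eichler_le(1)[OF det_\<Gamma>] 1(3,4)] by auto
qed

lemma slash_poly:
  assumes det: "det A = 1" and deg: "degree p \<le> n"
  shows "\<exists>q. degree q \<le> n \<and> (\<forall>z. cmod z \<le> 1 \<longrightarrow> slash n A (poly p) z = poly q z)"
proof -
  define q where "q = (\<Sum>i\<le>n. Polynomial.smult (poly.coeff p i) ([:beta A, alpha A:] ^ i * [:cnj (alpha A), cnj (beta A):] ^ (n - i)))"
  have "degree (Polynomial.smult (poly.coeff p i) ([:beta A, alpha A:] ^ i * [:cnj (alpha A), cnj (beta A):] ^ (n - i))) \<le> n"
    if "i \<le> n" for i
  proof -
    have "degree ([:beta A, alpha A:] ^ i * [:cnj (alpha A), cnj (beta A):] ^ (n - i)) \<le> 1 * i + 1 * (n - i)"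
      by (intro order_trans[OF degree_mult_le] add_mono order_trans[OF degree_power_le] mult_right_mono) auto
    then show ?thesis using that order_trans[OF degree_smult_le] by fastforce
  qed
  then have "degree q \<le> n" unfolding q_def by (intro degree_sum_le) auto
  moreover have "slash n A (poly p) z = poly q z" if z: "cmod z \<le> 1" for z
  proof -
    have nz: "aut A z \<noteq> 0" using aut_nonzero det z by blast
    have "poly p w = (\<Sum>i\<le>n. poly.coeff p i * w ^ i)" for w
      unfolding poly_altdef
      by (rule sum.mono_neutral_left) (use deg in \<open>auto simp: coeff_eq_0\<close>)
    then have "slash n A (poly p) z = (\<Sum>i\<le>n. aut A z ^ n * (poly.coeff p i * mob A z ^ i))"
      by (simp add: slash_def sum_distrib_left)
    also have "\<dots> = poly q z"
      unfolding q_def poly_sum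
    proof (intro sum.cong refl)
      fix i assume "i \<in> {..n}"
      then have "aut A z ^ n = aut A z ^ (n - i) * aut A z ^ i" by (simp flip: power_add)
      then show "aut A z ^ n * (poly.coeff p i * mob A z ^ i) =
          poly (Polynomial.smult (poly.coeff p i) ([:beta A, alpha A:] ^ i * [:cnj (alpha A), cnj (beta A):] ^ (n - i))) z"
        using nz by (simp add: mob_def power_divide num_def aut_def mult_ac add.commute)
    qed
    finally show ?thesis .
  qed
  ultimately show ?thesis by blast
qed

text \<open>
  Right translation changes \<open>|alpha|\<close> by a bounded factor only.
\<close>
lemma norm_alpha_mult_ge:
  assumes "det A = 1" "det B = 1"
  shows "cmod (alpha A) \<le> 2 * cmod (alpha B) * cmod (alpha (A ** B))"
proof -
  note A = alpha_beta_norm[OF assms(1)] and B = alpha_beta_norm[OF assms(2)]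
  have "cmod (alpha A) * (cmod (alpha B) - cmod (beta B)) \<le> cmod (alpha A) * cmod (alpha B) - cmod (beta A) * cmod (beta B)"
    using mult_right_mono[OF less_imp_le[OF A(2)], of "cmod (beta B)"] by (simp add: algebra_simps)
  also have "\<dots> \<le> cmod (alpha (A ** B))"
    using norm_triangle_ineq2[of "alpha A * alpha B" "- (beta A * cnj (beta B))"]
    by (simp add: alpha_mult norm_mult)
  finally have "cmod (alpha A) * (cmod (alpha B) - cmod (beta B)) * (2 * cmod (alpha B)) \<le> cmod (alpha (A ** B)) * (2 * cmod (alpha B))"
    by (rule mult_right_mono) simp
  moreover have "cmod (alpha A) * 1 \<le> cmod (alpha A) * ((cmod (alpha B) - cmod (beta B)) * (2 * cmod (alpha B)))"
    by (rule mult_left_mono[OF B(5)]) simp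
  ultimately show ?thesis by (simp add: mult_ac)
qed

text \<open>
  Summation of \<open>eichler_cocycle\<close> over \<open>\<Gamma>\<close>: the slash operator translates the coefficients, up to a period
  polynomial. The coefficients of the period are themselves convergent series.
\<close>
lemma slash_eichler_series:
  assumes x: "bounded_coeffs x" and \<delta>: "\<delta> \<in> \<Gamma>"
  shows "\<exists>q. degree q \<le> n \<and> (\<forall>z. cmod z \<le> 1 \<longrightarrow>
    slash n \<delta> (eichler_series x) z = eichler_series (\<lambda>\<gamma>. x (\<gamma> ** inv\<^bsub>SL2R\<^esub> \<delta>)) z + poly q z)"
proof -
  define c where "c = (\<lambda>\<gamma> i. beta \<delta> / (cnj (alpha \<gamma>) * cnj (alpha (\<gamma> ** \<delta>))) / cnj (alpha \<gamma>) ^ i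
        / cnj (alpha (\<gamma> ** \<delta>)) ^ (n - i))"
  define C where "C = (\<lambda>i. \<Sum>\<^sub>\<infinity>\<gamma>\<in>\<Gamma>. x \<gamma> * c \<gamma> i)"
  define q where "q = (\<Sum>i<Suc n. Polynomial.smult (C i) ([:beta \<delta>, alpha \<delta>:] ^ i * [:0, 1:] ^ (n - i)))"
  have det: "det \<delta> = 1" using det_\<Gamma> \<delta> by blast
  let ?d = "2 * cmod (alpha \<delta>)"
  have c_bound: "cmod (c \<gamma> i) \<le> (cmod (beta \<delta>) * ?d ^ n) * (1 / cmod (alpha \<gamma>) ^ n)"
    if "i < Suc n" "\<gamma> \<in> \<Gamma>" for \<gamma> i
  proof -
    let ?a = "cmod (alpha \<gamma>)" and ?b = "cmod (alpha (\<gamma> ** \<delta>))"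
    have a: "?a \<ge> 1" and b: "?b \<ge> 1" and d: "?d \<ge> 1"
      using alpha_beta_norm(3) det det_\<Gamma> mult_\<Gamma> \<delta> that by (auto intro: order_trans[of 1 "cmod (alpha \<delta>)"])
    have ab: "?a \<le> ?d * ?b" using norm_alpha_mult_ge det det_\<Gamma> that by blast
    have "?a ^ n = ?a ^ i * ?a ^ (n - i)" using that by (simp flip: power_add)
    also have "\<dots> \<le> ?a ^ i * (?d * ?b) ^ (n - i)"
      using ab by (intro mult_left_mono power_mono) auto
    also have "\<dots> = ?a ^ i * ?b ^ (n - i) * ?d ^ (n - i)" by (simp add: power_mult_distrib)
    also have "\<dots> \<le> ?a ^ i * ?b ^ (n - i) * ?d ^ n"
      using d by (intro mult_left_mono power_increasing) auto
    also have "\<dots> = 1 * (?a ^ i * ?b ^ (n - i) * ?d ^ n)" by simp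
    also have "\<dots> \<le> (?a * ?b) * (?a ^ i * ?b ^ (n - i) * ?d ^ n)"
      using mult_mono[OF a b] by (intro mult_right_mono) auto
    finally have key: "?a ^ n \<le> (?a * ?b * ?a ^ i * ?b ^ (n - i)) * ?d ^ n" by (simp add: mult_ac)
    have pos: "?a ^ n > 0" "?a * ?b * ?a ^ i * ?b ^ (n - i) > 0"
      using less_le_trans[OF zero_less_one a] less_le_trans[OF zero_less_one b]
      by (blast intro: mult_pos_pos zero_less_power)+
    have "1 / (?a * ?b * ?a ^ i * ?b ^ (n - i)) \<le> ?d ^ n * (1 / ?a ^ n)"
      using key pos by (simp add: field_simps)
    then have "cmod (beta \<delta>) * (1 / (?a * ?b * ?a ^ i * ?b ^ (n - i))) \<le> cmod (beta \<delta>) * (?d ^ n * (1 / ?a ^ n))"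
      by (rule mult_left_mono) simp
    then show ?thesis by (simp add: c_def norm_divide norm_mult norm_power mult_ac)
  qed
  have sc: "(\<lambda>\<gamma>. x \<gamma> * c \<gamma> i) summable_on \<Gamma>" if "i < Suc n" for i
    using x c_bound[OF that] by (rule summable_bounded_coeffs)
  have bij: "(\<Sum>\<^sub>\<infinity>\<gamma>\<in>\<Gamma>. x \<gamma> * eichler n (\<gamma> ** \<delta>) z) = eichler_series (\<lambda>\<gamma>. x (\<gamma> ** inv\<^bsub>SL2R\<^esub> \<delta>)) z" for z
    unfolding eichler_series_def
    by (rule infsum_reindex_bij_witness[of _ "\<lambda>\<gamma>. \<gamma> ** inv\<^bsub>SL2R\<^esub> \<delta>" "\<lambda>\<gamma>. \<gamma> ** \<delta>"])
      (auto simp: mult_inv_cancel[OF \<delta>] mult_\<Gamma> inv_\<Gamma> \<delta>)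
  have summ: "(\<lambda>\<gamma>. x \<gamma> * eichler n (\<gamma> ** \<delta>) z) summable_on \<Gamma>" if z: "cmod z \<le> 1" for z
  proof -
    have "(\<lambda>\<gamma>. x (\<gamma> ** inv\<^bsub>SL2R\<^esub> \<delta>) * eichler n \<gamma> z) summable_on \<Gamma>"
      by (intro summable_eichler_series bounded_coeffs_translate x inv_\<Gamma> \<delta> z)
    then show ?thesis
      by (subst summable_on_reindex_bij_witness[of _ "\<lambda>\<gamma>. \<gamma> ** inv\<^bsub>SL2R\<^esub> \<delta>" "\<lambda>\<gamma>. \<gamma> ** \<delta>"])
        (auto simp: mult_inv_cancel[OF \<delta>] mult_\<Gamma> inv_\<Gamma> \<delta>)
  qed
  have "degree (Polynomial.smult (C i) ([:beta \<delta>, alpha \<delta>:] ^ i * [:0, 1:] ^ (n - i))) \<le> n" if "i < Suc n" for i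
  proof -
    have "degree ([:beta \<delta>, alpha \<delta>:] ^ i * [:0, 1:] ^ (n - i)) \<le> 1 * i + 1 * (n - i)"
      by (intro order_trans[OF degree_mult_le] add_mono order_trans[OF degree_power_le] mult_right_mono) auto
    then show ?thesis using that order_trans[OF degree_smult_le] by fastforce
  qed
  then have "degree q \<le> n" unfolding q_def by (intro degree_sum_le) auto
  moreover have "slash n \<delta> (eichler_series x) z = eichler_series (\<lambda>\<gamma>. x (\<gamma> ** inv\<^bsub>SL2R\<^esub> \<delta>)) z + poly q z" if z: "cmod z \<le> 1" for z
  proof -
    have "slash n \<delta> (eichler_series x) z = (\<Sum>\<^sub>\<infinity>\<gamma>\<in>\<Gamma>. x \<gamma> * slash n \<delta> (eichler n \<gamma>) z)"
      unfolding slash_def eichler_series_def infsum_cmult_right'[symmetric] by (simp add: mult_ac)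
    also have "\<dots> = (\<Sum>\<^sub>\<infinity>\<gamma>\<in>\<Gamma>. x \<gamma> * eichler n (\<gamma> ** \<delta>) z +
        (\<Sum>i<Suc n. x \<gamma> * c \<gamma> i * (num \<delta> z ^ i * z ^ (n - i))))"
      by (intro infsum_cong)
        (simp only: eichler_cocycle[OF det_\<Gamma> det z] c_def distrib_left sum_distrib_left mult.assoc)
    also have "\<dots> = (\<Sum>\<^sub>\<infinity>\<gamma>\<in>\<Gamma>. x \<gamma> * eichler n (\<gamma> ** \<delta>) z) +
        (\<Sum>\<^sub>\<infinity>\<gamma>\<in>\<Gamma>. (\<Sum>i<Suc n. x \<gamma> * c \<gamma> i * (num \<delta> z ^ i * z ^ (n - i))))"
      by (intro infsum_add summ z infsum_finite_sum(1) summable_on_cmult_left sc) auto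
    also have "(\<Sum>\<^sub>\<infinity>\<gamma>\<in>\<Gamma>. (\<Sum>i<Suc n. x \<gamma> * c \<gamma> i * (num \<delta> z ^ i * z ^ (n - i))))
        = (\<Sum>i<Suc n. C i * (num \<delta> z ^ i * z ^ (n - i)))"
      unfolding C_def infsum_cmult_left'[symmetric]
      by (intro infsum_finite_sum(2) summable_on_cmult_left sc) auto
    also have "\<dots> = poly q z"
      unfolding q_def poly_sum by (intro sum.cong refl) (simp add: num_def mult_ac add.commute)
    finally show ?thesis using bij by simp
  qed
  ultimately show ?thesis by blast
qed

end

section \<open>Invariant Eichler integrals vanish\<close>

lemma slash_cong:
  assumes "det A = 1" "cmod z \<le> 1" "\<And>w. cmod w \<le> 1 \<Longrightarrow> f w = g w"
  shows "slash n A f z = slash n A g z"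
  unfolding slash_def using assms(3)[OF norm_mob_le[OF assms(1,2)]] by simp

context poincare_setting begin

lemma slash_invariant_generate:
  assumes S: "S \<subseteq> \<Gamma>"
    and inv: "\<And>s z. s \<in> S \<Longrightarrow> cmod z \<le> 1 \<Longrightarrow> slash n s \<Phi> z = \<Phi> z"
    and "\<delta> \<in> generate SL2R S" "cmod z \<le> 1"
  shows "slash n \<delta> \<Phi> z = \<Phi> z"
  using assms(3,4)
proof (induction arbitrary: z rule: generate.induct)
  case one
  then show ?case by simp
next
  case (incl s)
  then show ?case using inv by blast
next
  case (inv s)
  have s: "s \<in> \<Gamma>" using inv S by blast
  then have det: "det (inv\<^bsub>SL2R\<^esub> s) = 1" using inv_\<Gamma> det_\<Gamma> by blast
  have "\<Phi> z = slash n (s ** inv\<^bsub>SL2R\<^esub> s) \<Phi> z"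
    using mult_inv_cancel(1)[OF s, of "mat 1"] by simp
  also have "\<dots> = slash n (inv\<^bsub>SL2R\<^esub> s) (slash n s \<Phi>) z" by (rule slash_mult[OF det inv(2)])
  also have "\<dots> = slash n (inv\<^bsub>SL2R\<^esub> s) \<Phi> z"
    by (rule slash_cong[OF det inv(2)]) (rule assms(2)[OF inv(1)])
  finally show ?case by simp
next
  case (eng g h)
  have "generate SL2R S \<subseteq> \<Gamma>"
    by (rule group.generate_subgroup_incl[OF group_SL2R S subgroup_\<Gamma>])
  then have det: "det h = 1" using eng det_\<Gamma> by blast
  have "slash n (g \<otimes>\<^bsub>SL2R\<^esub> h) \<Phi> z = slash n h (slash n g \<Phi>) z"
    using slash_mult[OF det eng.prems] by simp
  also have "\<dots> = slash n h \<Phi> z"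
    by (rule slash_cong[OF det eng.prems]) (rule eng.IH(1))
  finally show ?case using eng.IH(2)[OF eng.prems] by simp
qed

text \<open>
  Invariance under \<open>\<Lambda>\<close> makes \<open>slash n \<gamma> \<Phi> 0\<close> a function of the coset of \<open>\<gamma>\<close>, so it takes finitely
  many values. Its norm is \<open>|alpha \<gamma>| ^ n\<close> times that of \<open>\<Phi>\<close> at \<open>mob \<gamma> 0\<close>: forms of negative weight
  decay along the orbit.
\<close>
lemma orbit_value_bound:
  assumes fin: "finite ((\<lambda>\<gamma>. \<Lambda> #>\<^bsub>SL2R\<^esub> \<gamma>) ` \<Gamma>)" and sub: "subgroup \<Lambda> SL2R" "\<Lambda> \<subseteq> \<Gamma>"
    and inv: "\<And>\<delta> z. \<delta> \<in> \<Lambda> \<Longrightarrow> cmod z \<le> 1 \<Longrightarrow> slash n \<delta> \<Phi> z = \<Phi> z"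
  obtains C where "C \<ge> 0" "\<And>\<gamma>. \<gamma> \<in> \<Gamma> \<Longrightarrow> cmod (\<Phi> (mob \<gamma> 0)) \<le> C / cmod (alpha \<gamma>) ^ n"
proof -
  have const: "slash n \<gamma> \<Phi> 0 = slash n \<delta> \<Phi> 0"
    if "\<gamma> \<in> \<Gamma>" "\<delta> \<in> \<Gamma>" "\<Lambda> #>\<^bsub>SL2R\<^esub> \<gamma> = \<Lambda> #>\<^bsub>SL2R\<^esub> \<delta>" for \<gamma> \<delta>
  proof -
    have "\<gamma> \<in> \<Lambda> #>\<^bsub>SL2R\<^esub> \<delta>"
      using group.rcos_self[OF group_SL2R _ sub(1), of \<gamma>] that det_\<Gamma> by auto
    then obtain l where l: "l \<in> \<Lambda>" "\<gamma> = l ** \<delta>" unfolding r_coset_def by auto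
    have det: "det \<delta> = 1" using det_\<Gamma> that by blast
    have "slash n \<gamma> \<Phi> 0 = slash n \<delta> (slash n l \<Phi>) 0" unfolding l by (rule slash_mult[OF det]) simp
    also have "\<dots> = slash n \<delta> \<Phi> 0" by (rule slash_cong[OF det]) (use inv l in auto)
    finally show ?thesis .
  qed
  define \<rho> where "\<rho> = (\<lambda>D. SOME \<gamma>. \<gamma> \<in> \<Gamma> \<and> D = \<Lambda> #>\<^bsub>SL2R\<^esub> \<gamma>)"
  have \<rho>: "\<rho> (\<Lambda> #>\<^bsub>SL2R\<^esub> \<gamma>) \<in> \<Gamma> \<and> \<Lambda> #>\<^bsub>SL2R\<^esub> \<gamma> = \<Lambda> #>\<^bsub>SL2R\<^esub> \<rho> (\<Lambda> #>\<^bsub>SL2R\<^esub> \<gamma>)" if "\<gamma> \<in> \<Gamma>" for \<gamma>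
    unfolding \<rho>_def by (rule someI_ex) (use that in blast)
  let ?V = "(\<lambda>D. cmod (slash n (\<rho> D) \<Phi> 0)) ` ((\<lambda>\<gamma>. \<Lambda> #>\<^bsub>SL2R\<^esub> \<gamma>) ` \<Gamma>)"
  define C where "C = Max ?V"
  have C: "cmod (slash n \<gamma> \<Phi> 0) \<le> C" if "\<gamma> \<in> \<Gamma>" for \<gamma>
  proof -
    have "slash n \<gamma> \<Phi> 0 = slash n (\<rho> (\<Lambda> #>\<^bsub>SL2R\<^esub> \<gamma>)) \<Phi> 0"
      using const \<rho>[OF that] that by blast
    then show ?thesis unfolding C_def using fin that by (intro Max_ge) auto
  qed
  show thesis
  proof (rule that[of C])
    show "C \<ge> 0" using C[OF one_\<Gamma>] norm_ge_zero order_trans by blast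
    fix \<gamma> assume g: "\<gamma> \<in> \<Gamma>"
    have "cmod (alpha \<gamma>) > 0" using alpha_beta_norm(4)[OF det_\<Gamma>[OF g]] by simp
    then show "cmod (\<Phi> (mob \<gamma> 0)) \<le> C / cmod (alpha \<gamma>) ^ n"
      using C[OF g] by (simp add: slash_def aut_def norm_mult norm_power field_simps)
  qed
qed

text \<open>
  Here \<open>1 / |alpha \<gamma>|\<close> is \<open>sqrt (1 - |w| ^ 2)\<close> for \<open>w = mob \<gamma> 0\<close>, so the decay along the orbit becomes a closed
  condition on \<open>w\<close>. It passes to limits of the orbit and forces \<open>\<Phi> = 0\<close> on the circle.
\<close>
lemma invariant_integral_zero:
  assumes n: "n > 0"
    and dense: "\<And>\<zeta> \<epsilon>. cmod \<zeta> = 1 \<Longrightarrow> \<epsilon> > 0 \<Longrightarrow> \<exists>\<gamma>\<in>\<Gamma>. cmod (mob \<gamma> 0 - \<zeta>) < \<epsilon>"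
    and cont: "continuous_on (cball 0 1) \<Phi>" and hol: "\<Phi> holomorphic_on ball 0 1"
    and fin: "finite ((\<lambda>\<gamma>. \<Lambda> #>\<^bsub>SL2R\<^esub> \<gamma>) ` \<Gamma>)" and sub: "subgroup \<Lambda> SL2R" "\<Lambda> \<subseteq> \<Gamma>"
    and inv: "\<And>\<delta> z. \<delta> \<in> \<Lambda> \<Longrightarrow> cmod z \<le> 1 \<Longrightarrow> slash n \<delta> \<Phi> z = \<Phi> z"
    and z: "cmod z \<le> 1"
  shows "\<Phi> z = 0"
proof -
  obtain C where C: "C \<ge> 0" "\<And>\<gamma>. \<gamma> \<in> \<Gamma> \<Longrightarrow> cmod (\<Phi> (mob \<gamma> 0)) \<le> C / cmod (alpha \<gamma>) ^ n"
    using orbit_value_bound[OF fin sub inv] by blast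
  define K where "K = {w \<in> cball 0 1. cmod (\<Phi> w) \<le> C * sqrt (1 - (cmod w)\<^sup>2)}"
  have "closed K" unfolding K_def
    by (intro continuous_on_closed_Collect_le continuous_intros cont) auto
  have orbit: "mob \<gamma> 0 \<in> K" if g: "\<gamma> \<in> \<Gamma>" for \<gamma>
  proof -
    note ab = alpha_beta_norm[OF det_\<Gamma>[OF g]]
    have pos: "cmod (alpha \<gamma>) > 0" using ab(4) by simp
    have "(cmod (mob \<gamma> 0))\<^sup>2 = (cmod (beta \<gamma>))\<^sup>2 / (cmod (alpha \<gamma>))\<^sup>2"
      by (simp add: mob_def num_def aut_def norm_divide power_divide)
    then have "1 - (cmod (mob \<gamma> 0))\<^sup>2 = ((cmod (alpha \<gamma>))\<^sup>2 - (cmod (beta \<gamma>))\<^sup>2) / (cmod (alpha \<gamma>))\<^sup>2"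
      using pos by (simp add: diff_divide_distrib)
    also have "\<dots> = (1 / cmod (alpha \<gamma>))\<^sup>2" unfolding ab(1) by (simp add: power_divide ab(1))
    finally have "1 - (cmod (mob \<gamma> 0))\<^sup>2 = (1 / cmod (alpha \<gamma>))\<^sup>2" .
    then have "sqrt (1 - (cmod (mob \<gamma> 0))\<^sup>2) = 1 / cmod (alpha \<gamma>)" using pos by simp
    moreover have "C / cmod (alpha \<gamma>) ^ n \<le> C / cmod (alpha \<gamma>)"
    proof (rule divide_left_mono)
      show "cmod (alpha \<gamma>) \<le> cmod (alpha \<gamma>) ^ n" using self_le_power[OF ab(3) n] .
    qed (use pos C in auto)
    ultimately show ?thesis
      unfolding K_def using C(2)[OF g] norm_mob_le[OF det_\<Gamma>[OF g], of 0] by simp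
  qed
  have bd: "\<Phi> \<zeta> = 0" if \<zeta>: "cmod \<zeta> = 1" for \<zeta>
  proof -
    have "\<zeta> \<in> closure K"
      unfolding closure_approachable dist_norm using dense[OF \<zeta>] orbit by blast
    then have "\<zeta> \<in> K" using \<open>closed K\<close> by simp
    then show ?thesis by (simp add: K_def \<zeta>)
  qed
  have "cmod (\<Phi> z) \<le> 0"
    by (rule maximum_modulus_frontier[of _ "cball 0 1"]) (use cont hol z bd in auto)
  then show ?thesis by simp
qed

text \<open>
  The case \<open>t = 1\<close> reads off the coefficient of \<open>z ^ (n+1)\<close>. Translates of the zero function under \<open>\<Gamma>\<close>, not only
  under \<open>\<Lambda>\<close>, give one relation for each coset, which is what determines \<open>x\<close>.
\<close>
lemma coefficient_relations:
  assumes x: "bounded_coeffs x" and p: "degree p \<le> n"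
    and zero: "\<And>z. cmod z \<le> 1 \<Longrightarrow> eichler_series x z + poly p z = 0"
    and t: "t \<in> \<Gamma>"
  shows "(\<Sum>\<^sub>\<infinity>\<gamma>\<in>\<Gamma>. x (\<gamma> ** t) * (1 / cnj (alpha \<gamma>) ^ (n + 2))) = 0"
proof -
  let ?t = "inv\<^bsub>SL2R\<^esub> t"
  have t': "?t \<in> \<Gamma>" using inv_\<Gamma> t by blast
  have tt: "inv\<^bsub>SL2R\<^esub> ?t = t" using group.inv_inv[OF group_SL2R] det_\<Gamma>[OF t] by simp
  let ?y = "\<lambda>\<gamma>. x (\<gamma> ** t)"
  have y: "bounded_coeffs ?y" using bounded_coeffs_translate x t by blast
  obtain q1 where q1: "degree q1 \<le> n"
    "\<And>z. cmod z \<le> 1 \<Longrightarrow> slash n ?t (eichler_series x) z = eichler_series ?y z + poly q1 z"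
    using slash_eichler_series[OF x t'] unfolding tt by blast
  obtain q2 where q2: "degree q2 \<le> n"
    "\<And>z. cmod z \<le> 1 \<Longrightarrow> slash n ?t (poly p) z = poly q2 z"
    using slash_poly[OF det_\<Gamma>[OF t'] p] by blast
  define q where "q = - (q1 + q2)"
  have "degree q \<le> n" unfolding q_def degree_minus by (rule degree_add_le[OF q1(1) q2(1)])
  then have coeffs: "poly.coeff q i = 0" if "i \<ge> Suc n" for i
    using that by (intro coeff_eq_0) auto
  have eq: "poly q z = z ^ Suc n * eichler_series_quot ?y z" if z: "cmod z \<le> 1" for z
  proof -
    have "0 = slash n ?t (\<lambda>w. eichler_series x w + poly p w) z"
      using zero[OF norm_mob_le[OF det_\<Gamma>[OF t'] z]] by (simp add: slash_def)
    also have "\<dots> = slash n ?t (eichler_series x) z + slash n ?t (poly p) z"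
      by (simp add: slash_def distrib_left)
    also have "\<dots> = eichler_series ?y z - poly q z"
      using q1(2)[OF z] q2(2)[OF z] by (simp add: q_def)
    finally show ?thesis by (simp only: eichler_series_eq_quot) simp
  qed
  have "isCont (eichler_series_quot ?y) 0"
    using continuous_on_interior[OF eichler_series_regular(3)[OF y], of 0] by simp
  with coeffs eq have "eichler_series_quot ?y 0 = 0"
    by (rule poly_divisible_by_power_imp_zero)
  moreover have "eichler_series_quot ?y 0 = (\<Sum>\<^sub>\<infinity>\<gamma>\<in>\<Gamma>. ?y \<gamma> * (1 / cnj (alpha \<gamma>) ^ (n + 2)))"
    unfolding eichler_series_quot_def by (intro infsum_cong) (simp add: aut_def)
  ultimately show ?thesis by simp
qed

end

section \<open>The index bound\<close>

lemma homogeneous_system_nontrivial_solution: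
  fixes a :: "'e \<Rightarrow> 'i \<Rightarrow> 'k::field"
  assumes "finite J" "finite I" "card J < card I"
  shows "\<exists>x. (\<exists>i\<in>I. x i \<noteq> 0) \<and> (\<forall>j\<in>J. (\<Sum>i\<in>I. a j i * x i) = 0)"
  using assms
proof (induction J arbitrary: I a rule: finite_induct)
  case empty
  then obtain i where "i \<in> I" by (metis card_gt_0_iff ex_in_conv card.empty)
  then show ?case by (intro exI[of _ "\<lambda>_. 1"]) auto
next
  case (insert j J)
  show ?case
  proof (cases "\<forall>i\<in>I. a j i = 0")
    case True
    with insert.IH[of I a] insert.prems insert.hyps show ?thesis by auto
  next
    case False
    then obtain i0 where i0: "i0 \<in> I" "a j i0 \<noteq> 0" by blast
    define I' where "I' = I - {i0}"
    define b where "b = (\<lambda>j' i. a j' i - a j' i0 * a j i / a j i0)"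
    have I': "finite I'" "card J < card I'"
      using insert.prems insert.hyps i0 by (auto simp: I'_def)
    obtain x where x: "\<exists>i\<in>I'. x i \<noteq> 0" "\<forall>j\<in>J. (\<Sum>i\<in>I'. b j i * x i) = 0"
      using insert.IH[OF I', of b] by blast
    define s where "s = (\<Sum>i\<in>I'. a j i * x i)"
    define y where "y = x(i0 := - s / a j i0)"
    have split: "(\<Sum>i\<in>I. a j' i * y i) = a j' i0 * y i0 + (\<Sum>i\<in>I'. a j' i * x i)" for j'
    proof -
      have "(\<Sum>i\<in>I. a j' i * y i) = a j' i0 * y i0 + (\<Sum>i\<in>I'. a j' i * y i)"
        unfolding I'_def using insert.prems i0 by (simp add: sum.remove)
      also have "(\<Sum>i\<in>I'. a j' i * y i) = (\<Sum>i\<in>I'. a j' i * x i)"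
        by (intro sum.cong) (auto simp: y_def I'_def)
      finally show ?thesis .
    qed
    have "(\<Sum>i\<in>I. a j i * y i) = 0"
      unfolding split using i0 by (simp add: y_def s_def)
    moreover have "(\<Sum>i\<in>I. a j' i * y i) = 0" if "j' \<in> J" for j'
    proof -
      have "0 = (\<Sum>i\<in>I'. b j' i * x i)" using x that by simp
      also have "\<dots> = (\<Sum>i\<in>I'. a j' i * x i - a j' i0 / a j i0 * (a j i * x i))"
        by (intro sum.cong) (auto simp: b_def field_simps)
      also have "\<dots> = (\<Sum>i\<in>I'. a j' i * x i) - a j' i0 / a j i0 * s"
        by (simp only: sum_subtractf s_def sum_distrib_left)
      finally show ?thesis unfolding split by (simp add: y_def)
    qed
    moreover have "\<exists>i\<in>I. y i \<noteq> 0"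
      using x(1) by (auto simp: y_def I'_def)
    ultimately show ?thesis by blast
  qed
qed

context poincare_setting begin

text \<open>
  The stabiliser of \<open>0\<close>, as \<open>mob \<gamma> 0 = beta \<gamma> / cnj (alpha \<gamma>)\<close>.
\<close>
definition stab :: "(real^2^2) set" where
  "stab = {\<gamma> \<in> \<Gamma>. beta \<gamma> = 0}"

lemma subgroup_stab: "subgroup stab SL2R"
proof (rule group.subgroupI[OF group_SL2R])
  show "stab \<subseteq> carrier SL2R" using det_\<Gamma> by (auto simp: stab_def)
  show "stab \<noteq> {}" using one_\<Gamma> by (auto simp: stab_def)
  show "inv\<^bsub>SL2R\<^esub> a \<in> stab" if "a \<in> stab" for a
    using that inv_\<Gamma> det_\<Gamma> by (simp add: stab_def alpha_beta_SL2R_inv)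
  show "a \<otimes>\<^bsub>SL2R\<^esub> b \<in> stab" if "a \<in> stab" "b \<in> stab" for a b
    using that mult_\<Gamma> by (simp add: stab_def beta_mult)
qed

text \<open>
  The relations form a diagonally dominant system. In the relation at a point \<open>t\<close> where \<open>|x|\<close> is
  maximal, the elements of the stabiliser of \<open>0\<close> contribute \<open>card stab * x t\<close>, because \<open>x\<close> is invariant and
  \<open>alpha ^ (n+2)\<close> is trivial there; all other terms together are smaller than \<open>|x t|\<close> unless \<open>x t = 0\<close>.
\<close>
lemma dominance_imp_zero:
  assumes x: "finite (x ` \<Gamma>)" and stab_inv: "\<And>\<zeta> \<gamma>. \<zeta> \<in> stab \<Longrightarrow> \<gamma> \<in> \<Gamma> \<Longrightarrow> x (\<zeta> ** \<gamma>) = x \<gamma>"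
    and stab: "finite stab" "\<And>\<gamma>. \<gamma> \<in> stab \<Longrightarrow> alpha \<gamma> ^ (n + 2) = 1"
    and small: "(\<Sum>\<^sub>\<infinity>\<gamma>\<in>\<Gamma> - stab. 1 / cmod (alpha \<gamma>) ^ (n + 2)) < 1"
    and rel: "\<And>t. t \<in> \<Gamma> \<Longrightarrow> (\<Sum>\<^sub>\<infinity>\<gamma>\<in>\<Gamma>. x (\<gamma> ** t) * (1 / cnj (alpha \<gamma>) ^ (n + 2))) = 0"
    and g: "\<gamma> \<in> \<Gamma>"
  shows "x \<gamma> = 0"
proof -
  let ?M = "Max ((\<lambda>\<gamma>. cmod (x \<gamma>)) ` \<Gamma>)"
  have fin: "finite ((\<lambda>\<gamma>. cmod (x \<gamma>)) ` \<Gamma>)"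
    using finite_imageI[OF x, of cmod] by (simp add: image_image)
  have le: "cmod (x \<gamma>) \<le> ?M" if "\<gamma> \<in> \<Gamma>" for \<gamma> using fin that by (intro Max_ge) auto
  have M0: "?M \<ge> 0" using le[OF one_\<Gamma>] norm_ge_zero order_trans by blast
  have "?M \<in> (\<lambda>\<gamma>. cmod (x \<gamma>)) ` \<Gamma>" using fin one_\<Gamma> by (intro Max_in) auto
  then obtain t where t: "t \<in> \<Gamma>" "cmod (x t) = ?M" by auto
  let ?h = "\<lambda>\<gamma>. x (\<gamma> ** t) * (1 / cnj (alpha \<gamma>) ^ (n + 2))"
  have a1: "cmod (alpha \<gamma>) \<ge> 1" if "\<gamma> \<in> \<Gamma>" for \<gamma> using alpha_beta_norm(3) det_\<Gamma> that by blast
  have powle: "1 / cmod (alpha \<gamma>) ^ (n + 2) \<le> 1 / cmod (alpha \<gamma>) ^ n" if "\<gamma> \<in> \<Gamma>" for \<gamma>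
  proof (rule divide_left_mono)
    show "cmod (alpha \<gamma>) ^ n \<le> cmod (alpha \<gamma>) ^ (n + 2)" by (rule power_increasing[OF _ a1[OF that]]) simp
    have "cmod (alpha \<gamma>) > 0" using a1[OF that] by linarith
    then show "0 < cmod (alpha \<gamma>) ^ (n + 2) * cmod (alpha \<gamma>) ^ n" by simp
  qed simp
  have nrm: "cmod (1 / cnj (alpha \<gamma>) ^ (n + 2)) = 1 / cmod (alpha \<gamma>) ^ (n + 2)" for \<gamma>
    by (simp only: norm_divide norm_power complex_mod_cnj norm_one)
  have "bounded_coeffs x" unfolding bounded_coeffs_def using le by blast
  then have bx: "bounded_coeffs (\<lambda>\<gamma>. x (\<gamma> ** t))" using t bounded_coeffs_translate by blast
  have summ: "?h summable_on \<Gamma>"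
    using bx by (rule summable_bounded_coeffs[where C = 1]) (use powle in \<open>simp only: nrm mult_1\<close>)
  have summ2: "(\<lambda>\<gamma>. ?M * (1 / cmod (alpha \<gamma>) ^ (n + 2))) summable_on \<Gamma> - stab"
    by (intro summable_on_cmult_right summable_on_comparison_test[OF summable_on_subset[OF summable_alpha]] powle) auto
  have sub: "stab \<subseteq> \<Gamma>" by (auto simp: stab_def)
  have "0 = infsum ?h (stab \<union> (\<Gamma> - stab))" using rel[OF t(1)] sub by (simp add: Un_absorb1)
  also have "\<dots> = infsum ?h stab + infsum ?h (\<Gamma> - stab)"
    by (intro infsum_Un_disjoint summable_on_subset[OF summ]) (use sub in auto)
  also have "infsum ?h stab = (\<Sum>\<gamma>\<in>stab. x t)"
    unfolding infsum_finite[OF stab(1)]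
  proof (intro sum.cong refl)
    fix \<gamma> assume "\<gamma> \<in> stab"
    moreover from this have "cnj (alpha \<gamma>) ^ (n + 2) = 1"
      using arg_cong[OF stab(2), of \<gamma> cnj] by (simp only: complex_cnj_power complex_cnj_one)
    ultimately show "?h \<gamma> = x t" using stab_inv[OF _ t(1), of \<gamma>] by (simp only: div_by_1 mult_1_right)
  qed
  finally have "of_nat (card stab) * x t = - infsum ?h (\<Gamma> - stab)"
    by (simp add: eq_neg_iff_add_eq_0)
  then have "cmod (of_nat (card stab) * x t) = cmod (- infsum ?h (\<Gamma> - stab))"
    by (rule arg_cong)
  then have "real (card stab) * ?M = cmod (infsum ?h (\<Gamma> - stab))"
    unfolding norm_mult t(2) norm_of_nat norm_minus_cancel .
  also have "\<dots> \<le> (\<Sum>\<^sub>\<infinity>\<gamma>\<in>\<Gamma> - stab. ?M * (1 / cmod (alpha \<gamma>) ^ (n + 2)))"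
  proof (rule norm_infsum_le[OF has_sum_infsum has_sum_infsum])
    show "?h summable_on \<Gamma> - stab" by (rule summable_on_subset[OF summ]) auto
    fix \<gamma> assume "\<gamma> \<in> \<Gamma> - stab"
    then have "\<gamma> ** t \<in> \<Gamma>" using mult_\<Gamma> t by blast
    then show "cmod (?h \<gamma>) \<le> ?M * (1 / cmod (alpha \<gamma>) ^ (n + 2))"
      unfolding norm_mult by (intro mult_mono le) (simp_all only: nrm M0 order_refl norm_ge_zero zero_le_divide_1_iff zero_le_power)
  qed (rule summ2)
  also have "\<dots> = ?M * (\<Sum>\<^sub>\<infinity>\<gamma>\<in>\<Gamma> - stab. 1 / cmod (alpha \<gamma>) ^ (n + 2))" by (rule infsum_cmult_right')
  finally have le1: "real (card stab) * ?M \<le> ?M * (\<Sum>\<^sub>\<infinity>\<gamma>\<in>\<Gamma> - stab. 1 / cmod (alpha \<gamma>) ^ (n + 2))" .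
  have "card stab > 0" using stab(1) one_\<Gamma> by (auto simp: stab_def card_gt_0_iff)
  then have "1 * ?M \<le> real (card stab) * ?M" using M0 by (intro mult_right_mono) auto
  with le1 have "?M * (1 - (\<Sum>\<^sub>\<infinity>\<gamma>\<in>\<Gamma> - stab. 1 / cmod (alpha \<gamma>) ^ (n + 2))) \<le> 0"
    by (simp add: right_diff_distrib)
  then have "?M \<le> 0" using small by (simp add: mult_le_0_iff)
  with le[OF g] have "cmod (x \<gamma>) \<le> 0" by (rule order_trans)
  then show ?thesis by simp
qed

lemma eichler_series_cong: "(\<And>\<gamma>. \<gamma> \<in> \<Gamma> \<Longrightarrow> x \<gamma> = y \<gamma>) \<Longrightarrow> eichler_series x z = eichler_series y z"
  unfolding eichler_series_def by (intro infsum_cong) auto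

lemma eichler_series_sum:
  assumes "finite Q" "\<And>D. D \<in> Q \<Longrightarrow> bounded_coeffs (f D)" "cmod z \<le> 1"
  shows "eichler_series (\<lambda>\<gamma>. \<Sum>D\<in>Q. f D \<gamma> * y D) z = (\<Sum>D\<in>Q. eichler_series (f D) z * y D)"
proof -
  have "eichler_series (\<lambda>\<gamma>. \<Sum>D\<in>Q. f D \<gamma> * y D) z = (\<Sum>\<^sub>\<infinity>\<gamma>\<in>\<Gamma>. \<Sum>D\<in>Q. f D \<gamma> * eichler n \<gamma> z * y D)"
    unfolding eichler_series_def sum_distrib_right by (intro infsum_cong sum.cong refl) (simp add: mult_ac)
  also have "\<dots> = (\<Sum>D\<in>Q. eichler_series (f D) z * y D)"
    unfolding eichler_series_def infsum_cmult_left'[symmetric]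
    by (intro infsum_finite_sum(2) summable_on_cmult_left summable_eichler_series assms)
  finally show ?thesis .
qed

text \<open>
  The defect of invariance is a polynomial of degree at most \<open>n\<close>, so it is detected by its values at
  \<open>n+1\<close> points. In this form invariance under \<open>s\<close> is a system of \<open>n+1\<close> linear equations.
\<close>
lemma invariant_if_invariant_at_points:
  assumes x: "bounded_coeffs x" and p: "degree p \<le> n" and s: "s \<in> \<Gamma>"
    and xs: "\<And>\<gamma>. \<gamma> \<in> \<Gamma> \<Longrightarrow> x (\<gamma> ** inv\<^bsub>SL2R\<^esub> s) = x \<gamma>"
    and pts: "finite P" "card P = Suc n" "\<And>z. z \<in> P \<Longrightarrow> cmod z \<le> 1"
    and eq: "\<And>z. z \<in> P \<Longrightarrow> slash n s (\<lambda>w. eichler_series x w + poly p w) z = eichler_series x z + poly p z"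
    and z: "cmod z \<le> 1"
  shows "slash n s (\<lambda>w. eichler_series x w + poly p w) z = eichler_series x z + poly p z"
proof -
  obtain q1 where q1: "degree q1 \<le> n"
    "\<And>z. cmod z \<le> 1 \<Longrightarrow> slash n s (eichler_series x) z = eichler_series (\<lambda>\<gamma>. x (\<gamma> ** inv\<^bsub>SL2R\<^esub> s)) z + poly q1 z"
    using slash_eichler_series[OF x s] by blast
  obtain q2 where q2: "degree q2 \<le> n"
    "\<And>z. cmod z \<le> 1 \<Longrightarrow> slash n s (poly p) z = poly q2 z"
    using slash_poly[OF det_\<Gamma>[OF s] p] by blast
  define q where "q = q1 + q2 - p"
  have deg: "degree q \<le> n" unfolding q_def by (intro degree_diff_le degree_add_le q1 q2 p)
  have key: "slash n s (\<lambda>w. eichler_series x w + poly p w) z = eichler_series x z + poly p z + poly q z" if z: "cmod z \<le> 1" for z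
  proof -
    have "slash n s (\<lambda>w. eichler_series x w + poly p w) z = slash n s (eichler_series x) z + slash n s (poly p) z"
      by (simp add: slash_def distrib_left)
    also have "\<dots> = eichler_series (\<lambda>\<gamma>. x (\<gamma> ** inv\<^bsub>SL2R\<^esub> s)) z + poly q1 z + poly q2 z"
      using q1(2)[OF z] q2(2)[OF z] by simp
    also have "eichler_series (\<lambda>\<gamma>. x (\<gamma> ** inv\<^bsub>SL2R\<^esub> s)) z = eichler_series x z" by (rule eichler_series_cong) (rule xs)
    finally show ?thesis by (simp add: q_def)
  qed
  have "q = 0"
  proof (rule poly_eqI_degree[of P])
    show "poly q z = poly 0 z" if "z \<in> P" for z
      using eq[OF that] key[OF pts(3)[OF that]] by simp
  qed (use pts deg in auto)
  then show ?thesis using key[OF z] by simp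
qed

text \<open>
  The dimension count. The unknowns are a function on the set \<open>Q\<close> of double cosets of \<open>stab\<close> and
  \<open>\<Lambda>\<close>, and a polynomial of degree at most \<open>n\<close>; the equations are invariance under \<open>S\<close>. Each double coset consists of
  at most \<open>card stab\<close> cosets of \<open>\<Lambda>\<close>.
\<close>
lemma index_le_generators:
  assumes n: "n > 0"
    and dense: "\<And>\<zeta> \<epsilon>. cmod \<zeta> = 1 \<Longrightarrow> \<epsilon> > 0 \<Longrightarrow> \<exists>\<gamma>\<in>\<Gamma>. cmod (mob \<gamma> 0 - \<zeta>) < \<epsilon>"
    and stab: "finite stab" "\<And>\<gamma>. \<gamma> \<in> stab \<Longrightarrow> alpha \<gamma> ^ (n + 2) = 1"
    and small: "(\<Sum>\<^sub>\<infinity>\<gamma>\<in>\<Gamma> - stab. 1 / cmod (alpha \<gamma>) ^ (n + 2)) < 1"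
    and sub: "subgroup \<Lambda> SL2R" "\<Lambda> \<subseteq> \<Gamma>"
    and fin: "finite ((\<lambda>\<gamma>. \<Lambda> #>\<^bsub>SL2R\<^esub> \<gamma>) ` \<Gamma>)"
    and S: "finite S" "S \<subseteq> \<Lambda>" "generate SL2R S = \<Lambda>"
  shows "card ((\<lambda>\<gamma>. \<Lambda> #>\<^bsub>SL2R\<^esub> \<gamma>) ` \<Gamma>) + card stab * Suc n \<le> card stab * Suc n * card S"
proof -
  interpret SL: group SL2R by (rule group_SL2R)
  \<comment> \<open>Coefficients have to be constant on left cosets of \<open>\<Lambda>\<close>, and the index counts right cosets; inversion
    exchanges the two. The set \<open>cls \<gamma>\<close> stands for the double coset of \<open>\<gamma>\<close>.\<close>
  define \<kappa> where "\<kappa> = (\<lambda>\<gamma>. \<Lambda> #>\<^bsub>SL2R\<^esub> inv\<^bsub>SL2R\<^esub> \<gamma>)"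
  define cls where "cls = (\<lambda>\<gamma>. (\<lambda>\<zeta>. \<kappa> (\<zeta> ** \<gamma>)) ` stab)"
  define Q where "Q = cls ` \<Gamma>"
  let ?R = "(\<lambda>\<gamma>. \<Lambda> #>\<^bsub>SL2R\<^esub> \<gamma>) ` \<Gamma>"
  have stab_sub: "stab \<subseteq> \<Gamma>" by (auto simp: stab_def)
  have carr: "\<gamma> \<in> carrier SL2R" if "\<gamma> \<in> \<Gamma>" for \<gamma> using det_\<Gamma>[OF that] by simp
  have stab_mult: "(\<lambda>\<zeta>. \<zeta> ** \<delta>) ` stab = stab" if \<delta>: "\<delta> \<in> stab" for \<delta>
  proof -
    have \<delta>\<Gamma>: "\<delta> \<in> \<Gamma>" using \<delta> stab_sub by blast
    have "\<delta>' ** inv\<^bsub>SL2R\<^esub> \<delta> \<in> stab" if "\<delta>' \<in> stab" for \<delta>'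
      using subgroup.m_closed[OF subgroup_stab that subgroup.m_inv_closed[OF subgroup_stab \<delta>]] by simp
    then have "\<delta>' \<in> (\<lambda>\<zeta>. \<zeta> ** \<delta>) ` stab" if "\<delta>' \<in> stab" for \<delta>'
      using that by (intro image_eqI[of _ _ "\<delta>' ** inv\<^bsub>SL2R\<^esub> \<delta>"]) (simp_all add: mult_inv_cancel[OF \<delta>\<Gamma>])
    moreover have "\<zeta> ** \<delta> \<in> stab" if "\<zeta> \<in> stab" for \<zeta>
      using subgroup.m_closed[OF subgroup_stab that \<delta>] by simp
    ultimately show ?thesis by blast
  qed
  have cls_left: "cls (\<delta> ** \<gamma>) = cls \<gamma>" if "\<delta> \<in> stab" for \<delta> \<gamma>
  proof -
    have "cls (\<delta> ** \<gamma>) = (\<lambda>\<zeta>. \<kappa> (\<zeta> ** \<gamma>)) ` ((\<lambda>\<zeta>. \<zeta> ** \<delta>) ` stab)"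
      unfolding cls_def image_image by (simp add: matrix_mul_assoc)
    then show ?thesis unfolding stab_mult[OF that] cls_def .
  qed
  have \<kappa>_right: "\<kappa> (\<gamma> ** \<delta>) = \<kappa> \<gamma>" if "\<gamma> \<in> \<Gamma>" "\<delta> \<in> \<Lambda>" for \<gamma> \<delta>
  proof -
    have d: "\<delta> \<in> \<Gamma>" "inv\<^bsub>SL2R\<^esub> \<delta> \<in> \<Lambda>"
      using that sub(2) subgroup.m_inv_closed[OF sub(1)] by auto
    have "inv\<^bsub>SL2R\<^esub> (\<gamma> ** \<delta>) = inv\<^bsub>SL2R\<^esub> \<delta> \<otimes>\<^bsub>SL2R\<^esub> inv\<^bsub>SL2R\<^esub> \<gamma>"
      using SL.inv_mult_group[OF carr[OF that(1)] carr[OF d(1)]] by simp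
    then have "\<kappa> (\<gamma> ** \<delta>) = (\<Lambda> #>\<^bsub>SL2R\<^esub> inv\<^bsub>SL2R\<^esub> \<delta>) #>\<^bsub>SL2R\<^esub> inv\<^bsub>SL2R\<^esub> \<gamma>"
      unfolding \<kappa>_def
      using SL.coset_mult_assoc[OF subgroup.subset[OF sub(1)] SL.inv_closed[OF carr[OF d(1)]] SL.inv_closed[OF carr[OF that(1)]]]
      by simp
    also have "\<Lambda> #>\<^bsub>SL2R\<^esub> inv\<^bsub>SL2R\<^esub> \<delta> = \<Lambda>"
      by (rule SL.coset_join2[OF _ sub(1) d(2)]) (rule SL.inv_closed[OF carr[OF d(1)]])
    finally show ?thesis by (simp add: \<kappa>_def)
  qed
  have cls_right: "cls (\<gamma> ** \<delta>) = cls \<gamma>" if "\<gamma> \<in> \<Gamma>" "\<delta> \<in> \<Lambda>" for \<gamma> \<delta>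
    unfolding cls_def matrix_mul_assoc
    by (intro image_cong refl \<kappa>_right mult_\<Gamma>) (use that stab_sub in auto)
  have \<kappa>R: "\<kappa> \<gamma> \<in> ?R" if "\<gamma> \<in> \<Gamma>" for \<gamma> unfolding \<kappa>_def using inv_\<Gamma> that by blast
  have "Q \<subseteq> Pow ?R" unfolding Q_def cls_def using \<kappa>R mult_\<Gamma> stab_sub by blast
  then have finQ: "finite Q" using fin by (meson finite_Pow_iff finite_subset)
  have "?R \<subseteq> \<Union>Q"
  proof
    fix c assume "c \<in> ?R"
    then obtain \<gamma> where g: "\<gamma> \<in> \<Gamma>" "c = \<Lambda> #>\<^bsub>SL2R\<^esub> \<gamma>" by blast
    have "c = \<kappa> (mat 1 ** inv\<^bsub>SL2R\<^esub> \<gamma>)" unfolding \<kappa>_def g(2) using SL.inv_inv[OF carr[OF g(1)]] by simp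
    moreover have "mat 1 \<in> stab" using one_\<Gamma> by (simp add: stab_def)
    ultimately show "c \<in> \<Union>Q" unfolding Q_def cls_def using inv_\<Gamma>[OF g(1)] by blast
  qed
  moreover have finUQ: "finite (\<Union>Q)" using finQ stab(1) by (auto simp: Q_def cls_def)
  ultimately have "card ?R \<le> card (\<Union>Q)" by (rule card_mono[rotated])
  also have "\<dots> \<le> (\<Sum>D\<in>Q. card D)" by (rule card_Union_le_sum_card)
  also have "\<dots> \<le> card Q * card stab"
    by (rule sum_bounded_above[where K = "card stab", simplified])
       (auto simp: Q_def cls_def intro: card_image_le stab(1))
  finally have cardR: "card ?R \<le> card Q * card stab" .
  have "card Q + Suc n \<le> card S * Suc n"
  proof (rule ccontr)
    assume few: "\<not> card Q + Suc n \<le> card S * Suc n"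
    define pt where "pt = (\<lambda>j. 1 / of_nat (Suc j) :: complex)"
    define J where "J = S \<times> {..n}"
    define I where "I = Q <+> {..n}"
    \<comment> \<open>The functions whose linear combinations are the sums of an Eichler integral and a polynomial.\<close>
    define B where "B = (\<lambda>i. case i of Inl D \<Rightarrow> eichler_series (\<lambda>\<gamma>. of_bool (cls \<gamma> = D)) | Inr k \<Rightarrow> (\<lambda>z. z ^ k))"
    have "finite J" "finite I" using S finQ by (auto simp: J_def I_def)
    moreover have "card J < card I"
      using few finQ by (simp add: J_def I_def card_cartesian_product card_Plus)
    ultimately obtain y where y: "\<exists>i\<in>I. y i \<noteq> 0"
      "\<forall>j\<in>J. (\<Sum>i\<in>I. (slash n (fst j) (B i) (pt (snd j)) - B i (pt (snd j))) * y i) = 0"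
      using homogeneous_system_nontrivial_solution[of J I "\<lambda>j i. slash n (fst j) (B i) (pt (snd j)) - B i (pt (snd j))"]
      by blast
    define x where "x = (\<lambda>\<gamma>. y (Inl (cls \<gamma>)))"
    define p where "p = (\<Sum>k\<le>n. Polynomial.monom (y (Inr k)) k)"
    define \<Phi> where "\<Phi> = (\<lambda>z. eichler_series x z + poly p z)"
    have finx: "finite (x ` \<Gamma>)"
      using finite_imageI[OF finQ, of "\<lambda>D. y (Inl D)"] by (simp add: x_def Q_def image_image)
    then have bx: "bounded_coeffs x"
      unfolding bounded_coeffs_def
      by (intro exI[of _ "Max (cmod ` x ` \<Gamma>)"]) (auto intro!: Max_ge)
    have degp: "degree p \<le> n" unfolding p_def
      by (intro degree_sum_le) (auto intro: order_trans[OF degree_monom_le])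
    have \<Phi>: "\<Phi> z = (\<Sum>i\<in>I. B i z * y i)" if z: "cmod z \<le> 1" for z
    proof -
      have "eichler_series x z = eichler_series (\<lambda>\<gamma>. \<Sum>D\<in>Q. of_bool (cls \<gamma> = D) * y (Inl D)) z"
        by (rule eichler_series_cong) (use finQ in \<open>simp add: x_def Q_def of_bool_def if_distrib[of "\<lambda>u. u * _"] sum.delta' cong: if_cong\<close>)
      also have "\<dots> = (\<Sum>D\<in>Q. eichler_series (\<lambda>\<gamma>. of_bool (cls \<gamma> = D)) z * y (Inl D))"
        by (rule eichler_series_sum[OF finQ _ z]) (auto simp: bounded_coeffs_def intro!: exI[of _ 1])
      finally have "eichler_series x z = (\<Sum>D\<in>Q. eichler_series (\<lambda>\<gamma>. of_bool (cls \<gamma> = D)) z * y (Inl D))" .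
      moreover have "poly p z = (\<Sum>k\<le>n. z ^ k * y (Inr k))"
        unfolding p_def poly_sum by (simp add: poly_monom mult.commute)
      ultimately show ?thesis
        using finQ by (simp add: \<Phi>_def I_def B_def sum.Plus)
    qed
    have S\<Gamma>: "S \<subseteq> \<Gamma>" using S sub by blast
    have inv_pts: "slash n s \<Phi> (pt j) = \<Phi> (pt j)" if s: "s \<in> S" and j: "j \<le> n" for s j
    proof -
      have pj: "cmod (pt j) \<le> 1" by (simp add: pt_def norm_divide del: of_nat_Suc)
      have det: "det s = 1" using s S\<Gamma> det_\<Gamma> by blast
      have "slash n s \<Phi> (pt j) - \<Phi> (pt j) = (\<Sum>i\<in>I. (slash n s (B i) (pt j) - B i (pt j)) * y i)"
        unfolding slash_def \<Phi>[OF pj] \<Phi>[OF norm_mob_le[OF det pj]]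
        by (simp add: sum_distrib_left left_diff_distrib sum_subtractf mult.assoc)
      also have "\<dots> = 0" using y(2) s j by (auto simp: J_def)
      finally show ?thesis by simp
    qed
    have inj: "inj_on pt {..n}"
      by (rule inj_onI) (simp add: pt_def field_simps del: of_nat_Suc)
    have inv_S: "slash n s \<Phi> z = \<Phi> z" if s: "s \<in> S" and z: "cmod z \<le> 1" for s z
      unfolding \<Phi>_def
    proof (rule invariant_if_invariant_at_points[OF bx degp, where P = "pt ` {..n}"])
      show "s \<in> \<Gamma>" using s S\<Gamma> by blast
      show "card (pt ` {..n}) = Suc n" using card_image[OF inj] by simp
      show "x (\<gamma> ** inv\<^bsub>SL2R\<^esub> s) = x \<gamma>" if "\<gamma> \<in> \<Gamma>" for \<gamma>
        unfolding x_def using cls_right[OF that subgroup.m_inv_closed[OF sub(1)], of s] s S(2) by auto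
      show "cmod z \<le> 1" if "z \<in> pt ` {..n}" for z
        using that by (auto simp: pt_def norm_divide simp del: of_nat_Suc)
      show "slash n s (\<lambda>w. eichler_series x w + poly p w) z = eichler_series x z + poly p z" if "z \<in> pt ` {..n}" for z
        using inv_pts[OF s] that unfolding \<Phi>_def by auto
    qed (use z in auto)
    have inv_\<Lambda>: "slash n \<delta> \<Phi> z = \<Phi> z" if "\<delta> \<in> \<Lambda>" "cmod z \<le> 1" for \<delta> z
      by (rule slash_invariant_generate[OF S\<Gamma> inv_S]) (use that S in auto)
    have zero: "\<Phi> z = 0" if "cmod z \<le> 1" for z
    proof (rule invariant_integral_zero[OF n dense _ _ fin sub inv_\<Lambda> that])
      show "continuous_on (cball 0 1) \<Phi>" "\<Phi> holomorphic_on ball 0 1"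
        unfolding \<Phi>_def using eichler_series_regular(1,2)[OF bx] by (auto intro!: continuous_intros holomorphic_intros)
    qed
    have rel: "(\<Sum>\<^sub>\<infinity>\<gamma>\<in>\<Gamma>. x (\<gamma> ** t) * (1 / cnj (alpha \<gamma>) ^ (n + 2))) = 0" if "t \<in> \<Gamma>" for t
      using coefficient_relations[OF bx degp _ that] zero unfolding \<Phi>_def by blast
    have x0: "x \<gamma> = 0" if "\<gamma> \<in> \<Gamma>" for \<gamma>
    proof (rule dominance_imp_zero[OF finx _ stab small rel that])
      show "x (\<zeta> ** \<gamma>) = x \<gamma>" if "\<zeta> \<in> stab" for \<zeta> \<gamma> unfolding x_def cls_left[OF that] ..
    qed
    have series0: "eichler_series x z = 0" for z using eichler_series_cong[of x "\<lambda>_. 0" z] x0 by (simp add: eichler_series_def)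
    have "p = 0"
    proof (rule poly_eqI_degree[of "pt ` {..n}"])
      show "poly p z = poly 0 z" if "z \<in> pt ` {..n}" for z
      proof -
        have "cmod z \<le> 1" using that by (auto simp: pt_def norm_divide simp del: of_nat_Suc)
        then show ?thesis using zero[of z] series0 by (simp add: \<Phi>_def)
      qed
    qed (use degp card_image[OF inj] in auto)
    moreover have "poly.coeff p k = y (Inr k)" if "k \<le> n" for k
      using that by (simp add: p_def coeff_sum sum.delta')
    ultimately have "y (Inr k) = 0" if "k \<le> n" for k using that by fastforce
    moreover have "y (Inl D) = 0" if "D \<in> Q" for D
      using that x0 by (auto simp: Q_def x_def)
    ultimately show False using y(1) by (auto simp: I_def)
  qed
  then have "(card Q + Suc n) * card stab \<le> (card S * Suc n) * card stab" by (rule mult_right_mono) simp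
  with cardR show ?thesis by (simp add: algebra_simps)
qed

end

section \<open>Counting elements of a discrete subgroup\<close>

lemma norm_matrix_le: "norm A \<le> \<bar>A$1$1\<bar> + \<bar>A$1$2\<bar> + \<bar>A$2$1\<bar> + \<bar>A$2$2\<bar>" for A :: "real^2^2"
proof -
  have "norm A \<le> norm (A$1) + norm (A$2)"
    unfolding norm_vec_def[of A] using L2_set_le_sum[of UNIV "\<lambda>i. norm (A$i)"] by (simp add: sum_2)
  also have "\<dots> \<le> (\<bar>A$1$1\<bar> + \<bar>A$1$2\<bar>) + (\<bar>A$2$1\<bar> + \<bar>A$2$2\<bar>)"
    using norm_le_l1_cart[of "A$1"] norm_le_l1_cart[of "A$2"] by (simp add: sum_2)
  finally show ?thesis by simp
qed

lemma dist_one_le: "dist (mat 1) A \<le> 4 * (cmod (alpha A - 1) + cmod (beta A))"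
proof -
  have e: "\<bar>A$1$1 - 1\<bar> \<le> cmod (alpha A - 1) + cmod (beta A)" "\<bar>A$1$2\<bar> \<le> cmod (alpha A - 1) + cmod (beta A)"
    "\<bar>A$2$1\<bar> \<le> cmod (alpha A - 1) + cmod (beta A)" "\<bar>A$2$2 - 1\<bar> \<le> cmod (alpha A - 1) + cmod (beta A)"
    unfolding matrix_entries_alpha_beta
    using abs_Re_le_cmod[of "alpha A - 1"] abs_Im_le_cmod[of "alpha A - 1"]
      abs_Re_le_cmod[of "beta A"] abs_Im_le_cmod[of "beta A"] by auto
  have "dist (mat 1) A = norm (A - mat 1)" by (simp add: dist_norm norm_minus_commute)
  also have "\<dots> \<le> \<bar>A$1$1 - 1\<bar> + \<bar>A$1$2\<bar> + \<bar>A$2$1\<bar> + \<bar>A$2$2 - 1\<bar>"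
    using norm_matrix_le[of "A - mat 1"] by (simp add: mat_def)
  also have "\<dots> \<le> (cmod (alpha A - 1) + cmod (beta A)) + (cmod (alpha A - 1) + cmod (beta A))
      + (cmod (alpha A - 1) + cmod (beta A)) + (cmod (alpha A - 1) + cmod (beta A))"
    by (intro add_mono e)
  finally show ?thesis by simp
qed

definition height :: "real^2^2 \<Rightarrow> nat" where
  "height A = nat \<lceil>cmod (alpha A)\<rceil>"

text \<open>
  Two elements of height \<open>k\<close> at distance much less than \<open>1 / k\<close> have a quotient close to \<open>1\<close>, so they are
  equal by discreteness. Hence a grid of mesh \<open>1 / (K k)\<close> in the four real coordinates separates
  the elements of height \<open>k\<close>, and \<open>O(k ^ 2)\<close> values of each coordinate are possible.
\<close>
lemma discrete_subgroup_height_count: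
  assumes sub: "subgroup \<Gamma> SL2R" and disc: "discrete \<Gamma>"
  obtains C :: nat where "\<And>k. finite {\<gamma> \<in> \<Gamma>. height \<gamma> = k}"
    "\<And>k. k > 0 \<Longrightarrow> card {\<gamma> \<in> \<Gamma>. height \<gamma> = k} \<le> C * k ^ 8"
proof -
  interpret group SL2R by (rule group_SL2R)
  have det: "det \<gamma> = 1" if "\<gamma> \<in> \<Gamma>" for \<gamma> using subgroup.mem_carrier[OF sub that] by simp
  have one: "mat 1 \<in> \<Gamma>" using subgroup.one_closed[OF sub] by simp
  obtain \<epsilon> where \<epsilon>: "\<epsilon> > 0" "\<And>A. A \<in> \<Gamma> \<Longrightarrow> dist (mat 1) A < \<epsilon> \<Longrightarrow> A = mat 1"
    using discreteD[OF disc one] unfolding isolated_in_dist_Ex_iff by blast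
  \<comment> \<open>Agreement of the cells yields \<open>|alpha - 1|, |beta| \<le> 4 / K\<close> for the quotient, hence distance at most
    \<open>32 / K\<close> from the identity matrix.\<close>
  obtain K :: nat where K: "32 / \<epsilon> < K" using reals_Archimedean2 by blast
  have "32 / \<epsilon> > 0" using \<epsilon> by simp
  then have K0: "real K > 0" using K by linarith
  define q where "q = (\<lambda>k u. \<lfloor>u * (real K * real k)\<rfloor>)"
  define g where "g = (\<lambda>k \<gamma>. (q k (Re (alpha \<gamma>)), q k (Im (alpha \<gamma>)), q k (Re (beta \<gamma>)), q k (Im (beta \<gamma>))))"
  define L where "L = (\<lambda>k::nat. {- int (K * k\<^sup>2) .. int (K * k\<^sup>2)})"
  let ?\<Gamma> = "\<lambda>k. {\<gamma> \<in> \<Gamma>. height \<gamma> = k}"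
  have hk: "cmod (alpha \<gamma>) \<le> real k" "cmod (beta \<gamma>) \<le> real k" "k > 0" if "\<gamma> \<in> ?\<Gamma> k" for \<gamma> k
  proof -
    note ab = alpha_beta_norm[OF det[of \<gamma>]]
    show 1: "cmod (alpha \<gamma>) \<le> real k" using that real_nat_ceiling_ge[of "cmod (alpha \<gamma>)"] by (auto simp: height_def)
    then show "cmod (beta \<gamma>) \<le> real k" using ab(2) that by auto
    show "k > 0" using 1 ab(3) that by (cases k) auto
  qed
  have close: "\<bar>u - v\<bar> \<le> 1 / (real K * real k)" if "q k u = q k v" "k > 0" for u v k
  proof -
    have "\<bar>u * (real K * real k) - v * (real K * real k)\<bar> \<le> 1"
      using that(1) unfolding q_def by linarith
    then have "\<bar>u - v\<bar> * (real K * real k) \<le> 1"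
      by (simp add: left_diff_distrib[symmetric] abs_mult)
    then show ?thesis using K0 that(2) by (simp add: field_simps)
  qed
  have inj: "inj_on (g k) (?\<Gamma> k)" for k
  proof (rule inj_onI)
    fix \<gamma> \<delta> assume g: "\<gamma> \<in> ?\<Gamma> k" and d: "\<delta> \<in> ?\<Gamma> k" and eq: "g k \<gamma> = g k \<delta>"
    note k = hk(3)[OF g]
    have cl: "\<bar>Re (alpha \<delta> - alpha \<gamma>)\<bar> \<le> 1 / (real K * real k)" "\<bar>Im (alpha \<delta> - alpha \<gamma>)\<bar> \<le> 1 / (real K * real k)"
      "\<bar>Re (beta \<delta> - beta \<gamma>)\<bar> \<le> 1 / (real K * real k)" "\<bar>Im (beta \<delta> - beta \<gamma>)\<bar> \<le> 1 / (real K * real k)"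
      using eq close[OF _ k] unfolding g_def by (simp_all add: abs_minus_commute)
    have \<Delta>: "cmod (alpha \<delta> - alpha \<gamma>) \<le> 2 / (real K * real k)" "cmod (beta \<delta> - beta \<gamma>) \<le> 2 / (real K * real k)"
      using cmod_le[of "alpha \<delta> - alpha \<gamma>"] cmod_le[of "beta \<delta> - beta \<gamma>"] cl by auto
    let ?A = "inv\<^bsub>SL2R\<^esub> \<gamma> ** \<delta>"
    have dg: "det \<gamma> = 1" "det \<delta> = 1" using g d det by auto
    have "alpha \<gamma> * cnj (alpha \<gamma>) - beta \<gamma> * cnj (beta \<gamma>) = 1"
      using alpha_beta_norm(1)[OF dg(1)] by (simp flip: complex_norm_square of_real_power)
    then have a: "alpha ?A - 1 = cnj (alpha \<gamma>) * (alpha \<delta> - alpha \<gamma>) - beta \<gamma> * cnj (beta \<delta> - beta \<gamma>)"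
      by (simp add: alpha_mult alpha_beta_SL2R_inv[OF dg(1)] algebra_simps)
    have b: "beta ?A = cnj (alpha \<gamma>) * (beta \<delta> - beta \<gamma>) - beta \<gamma> * cnj (alpha \<delta> - alpha \<gamma>)"
      by (simp add: beta_mult alpha_beta_SL2R_inv[OF dg(1)] algebra_simps)
    have bound: "cmod (cnj (alpha \<gamma>) * u - beta \<gamma> * cnj v) \<le> 4 / real K"
      if "cmod u \<le> 2 / (real K * real k)" "cmod v \<le> 2 / (real K * real k)" for u v
    proof -
      have "cmod (cnj (alpha \<gamma>) * u - beta \<gamma> * cnj v) \<le> cmod (alpha \<gamma>) * cmod u + cmod (beta \<gamma>) * cmod v"
        using norm_triangle_ineq4[of "cnj (alpha \<gamma>) * u" "beta \<gamma> * cnj v"] by (simp add: norm_mult)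
      also have "\<dots> \<le> real k * (2 / (real K * real k)) + real k * (2 / (real K * real k))"
        by (intro add_mono mult_mono hk[OF g] that) auto
      also have "\<dots> = 4 / real K" using k by (simp add: field_simps)
      finally show ?thesis .
    qed
    have "dist (mat 1) ?A \<le> 4 * (4 / real K + 4 / real K)"
      by (rule order_trans[OF dist_one_le], unfold a b, intro mult_left_mono add_mono bound \<Delta>) simp
    also have "\<dots> < \<epsilon>" using K K0 \<epsilon>(1) by (simp add: field_simps)
    finally have "?A = mat 1"
      using \<epsilon>(2) subgroup.m_closed[OF sub subgroup.m_inv_closed[OF sub]] g d by auto
    then have "\<gamma> ** ?A = \<gamma>" by simp
    then show "\<gamma> = \<delta>"
      using r_inv[of \<gamma>] dg(1) by (simp add: matrix_mul_assoc)
  qed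
  have range: "g k ` ?\<Gamma> k \<subseteq> L k \<times> L k \<times> L k \<times> L k" for k
  proof -
    have qL: "q k u \<in> L k" if "\<bar>u\<bar> \<le> real k" for u
    proof -
      have "\<bar>u * (real K * real k)\<bar> \<le> real k * (real K * real k)"
        unfolding abs_mult[of u] using that by (intro mult_mono) auto
      also have "\<dots> = of_int (int (K * k\<^sup>2))" by (simp add: power2_eq_square)
      finally have le: "\<bar>u * (real K * real k)\<bar> \<le> of_int (int (K * k\<^sup>2))" .
      then have "of_int (- int (K * k\<^sup>2)) \<le> u * (real K * real k)" "u * (real K * real k) \<le> of_int (int (K * k\<^sup>2))"
        by (simp_all only: of_int_minus abs_le_iff) linarith+
      then have "- int (K * k\<^sup>2) \<le> q k u" "q k u \<le> \<lfloor>of_int (int (K * k\<^sup>2)) :: real\<rfloor>"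
        unfolding q_def by (simp_all only: le_floor_iff[of "- int (K * k\<^sup>2)"] floor_mono)
      then show ?thesis unfolding L_def atLeastAtMost_iff floor_of_int by blast
    qed
    show ?thesis
    proof
      fix y assume "y \<in> g k ` ?\<Gamma> k"
      then obtain \<gamma> where g: "\<gamma> \<in> ?\<Gamma> k" "y = g k \<gamma>" by blast
      show "y \<in> L k \<times> L k \<times> L k \<times> L k" unfolding g(2) g_def mem_Times_iff fst_conv snd_conv
        using hk[OF g(1)] abs_Re_le_cmod[of "alpha \<gamma>"] abs_Im_le_cmod[of "alpha \<gamma>"]
          abs_Re_le_cmod[of "beta \<gamma>"] abs_Im_le_cmod[of "beta \<gamma>"]
        by (intro conjI qL) linarith+
    qed
  qed
  have finL: "finite (L k \<times> L k \<times> L k \<times> L k)" for k unfolding L_def by auto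
  show thesis
  proof (rule that[of "(3 * K) ^ 4"])
    show "finite (?\<Gamma> k)" for k using inj_on_finite[OF inj range finL] .
    fix k :: nat assume k: "k > 0"
    have "K * k\<^sup>2 > 0" using K0 k by simp
    moreover have "card {- int m..int m} = 2 * m + 1" for m by simp
    then have "card (L k) = 2 * (K * k\<^sup>2) + 1" unfolding L_def .
    ultimately have "card (L k) \<le> 3 * (K * k\<^sup>2)" by linarith
    then have "card (L k) \<le> 3 * K * k\<^sup>2" by (simp only: mult.assoc)
    then have "card (L k) ^ 4 \<le> (3 * K * k\<^sup>2) ^ 4" by (rule power_mono) simp
    moreover have "card (?\<Gamma> k) \<le> card (L k \<times> L k \<times> L k \<times> L k)" by (rule card_inj_on_le[OF inj range finL])
    moreover have "card (L k \<times> L k \<times> L k \<times> L k) = card (L k) ^ 4"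
      by (simp add: card_cartesian_product power4_eq_xxxx)
    ultimately show "card (?\<Gamma> k) \<le> (3 * K) ^ 4 * k ^ 8"
      by (simp add: power_mult_distrib flip: power_mult)
  qed
qed

lemma summable_alpha_discrete:
  assumes sub: "subgroup \<Gamma> SL2R" and disc: "discrete \<Gamma>"
  shows "(\<lambda>\<gamma>. 1 / cmod (alpha \<gamma>) ^ 10) summable_on \<Gamma>"
proof -
  have det: "det \<gamma> = 1" if "\<gamma> \<in> \<Gamma>" for \<gamma> using subgroup.mem_carrier[OF sub that] by simp
  obtain C :: nat where C: "\<And>k. finite {\<gamma> \<in> \<Gamma>. height \<gamma> = k}"
    "\<And>k. k > 0 \<Longrightarrow> card {\<gamma> \<in> \<Gamma>. height \<gamma> = k} \<le> C * k ^ 8"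
    using discrete_subgroup_height_count[OF sub disc] by blast
  have hpos: "height \<gamma> > 0" "1 / cmod (alpha \<gamma>) ^ 10 \<le> 2 ^ 10 / real (height \<gamma>) ^ 10" if "\<gamma> \<in> \<Gamma>" for \<gamma>
  proof -
    have a: "cmod (alpha \<gamma>) \<ge> 1" using alpha_beta_norm(3)[OF det[OF that]] .
    then show h: "height \<gamma> > 0" unfolding height_def by linarith
    then have a0: "cmod (alpha \<gamma>) > 0" using a by linarith
    have "real (height \<gamma>) \<le> cmod (alpha \<gamma>) + 1"
      unfolding height_def using of_int_ceiling_le_add_one[of "cmod (alpha \<gamma>)"] a
      by (simp add: of_nat_nat)
    then have "real (height \<gamma>) / 2 \<le> cmod (alpha \<gamma>)" using a by simp
    then have "(real (height \<gamma>) / 2) ^ 10 \<le> cmod (alpha \<gamma>) ^ 10" by (rule power_mono) simp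
    then have "1 / cmod (alpha \<gamma>) ^ 10 \<le> 1 / (real (height \<gamma>) / 2) ^ 10"
      using h a0 by (intro divide_left_mono) auto
    then show "1 / cmod (alpha \<gamma>) ^ 10 \<le> 2 ^ 10 / real (height \<gamma>) ^ 10" by (simp add: power_divide)
  qed
  have sq: "summable (\<lambda>k. inverse (real k ^ 2))" by (rule inverse_power_summable) simp
  show ?thesis
  proof (rule nonneg_bdd_above_summable_on)
    show "bdd_above (sum (\<lambda>\<gamma>. 1 / cmod (alpha \<gamma>) ^ 10) ` {F. F \<subseteq> \<Gamma> \<and> finite F})"
    proof (rule bdd_aboveI2)
      fix X assume "X \<in> {F. F \<subseteq> \<Gamma> \<and> finite F}"
      then have X: "X \<subseteq> \<Gamma>" "finite X" by auto
      have "(\<Sum>\<gamma>\<in>X. 1 / cmod (alpha \<gamma>) ^ 10) \<le> (\<Sum>\<gamma>\<in>X. 2 ^ 10 / real (height \<gamma>) ^ 10)"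
        using X hpos by (intro sum_mono) auto
      also have "\<dots> = (\<Sum>k\<in>height ` X. \<Sum>\<gamma>\<in>{\<gamma> \<in> X. height \<gamma> = k}. 2 ^ 10 / real (height \<gamma>) ^ 10)"
        by (rule sum.image_gen[OF X(2)])
      also have "\<dots> \<le> (\<Sum>k\<in>height ` X. (2 ^ 10 * real C) * inverse (real k ^ 2))"
      proof (rule sum_mono)
        fix k assume "k \<in> height ` X"
        then have k: "k > 0" using hpos X by auto
        have "card {\<gamma> \<in> X. height \<gamma> = k} \<le> card {\<gamma> \<in> \<Gamma>. height \<gamma> = k}"
          using X by (intro card_mono C) auto
        also have "\<dots> \<le> C * k ^ 8" by (rule C(2)[OF k])
        finally have "real (card {\<gamma> \<in> X. height \<gamma> = k}) \<le> real (C * k ^ 8)"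
          by (rule of_nat_mono)
        then have "real (card {\<gamma> \<in> X. height \<gamma> = k}) \<le> real C * real k ^ 8" by simp
        then have "real (card {\<gamma> \<in> X. height \<gamma> = k}) * (2 ^ 10 / real k ^ 10) \<le> real C * real k ^ 8 * (2 ^ 10 / real k ^ 10)"
          by (rule mult_right_mono) simp
        also have "\<dots> = (2 ^ 10 * real C) * inverse (real k ^ 2)"
        proof -
          have pow: "real k ^ 10 = real k ^ 8 * real k ^ 2" by (simp flip: power_add)
          have "c * a * (d / (a * b)) = d * c * inverse b" if "a \<noteq> 0" for a b c d :: real
            using that by (simp add: field_simps)
          from this[of "real k ^ 8"] show ?thesis unfolding pow using k by (metis of_nat_0_less_iff less_irrefl zero_less_power)
        qed
        finally show "(\<Sum>\<gamma>\<in>{\<gamma> \<in> X. height \<gamma> = k}. 2 ^ 10 / real (height \<gamma>) ^ 10) \<le> (2 ^ 10 * real C) * inverse (real k ^ 2)"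
          by simp
      qed
      also have "\<dots> = (2 ^ 10 * real C) * (\<Sum>k\<in>height ` X. inverse (real k ^ 2))"
        by (rule sum_distrib_left[symmetric])
      also have "\<dots> \<le> (2 ^ 10 * real C) * (\<Sum>k. inverse (real k ^ 2))"
        using X by (intro mult_left_mono sum_le_suminf sq) auto
      finally show "(\<Sum>\<gamma>\<in>X. 1 / cmod (alpha \<gamma>) ^ 10) \<le> (2 ^ 10 * real C) * (\<Sum>k. inverse (real k ^ 2))" .
    qed
  qed simp
qed

section \<open>Orbits of a lattice accumulate at the whole circle\<close>

lemma continuous_matrix_mult_right: "continuous_on UNIV (\<lambda>x::real^2^2. x ** A)"
  and continuous_matrix_mult_left: "continuous_on UNIV (\<lambda>x::real^2^2. A ** x)"
  unfolding matrix_matrix_mult_def by (intro continuous_on_vec_lambda continuous_intros)+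

text \<open>
  Poincare recurrence on \<open>\<Gamma> \ SL(2,R)\<close>. The images of \<open>W g i\<close> in the quotient are open sets of the same
  measure. This measure is positive, because countably many translates cover the quotient; so by
  finiteness of the total measure two of the images meet.
\<close>
lemma lattice_recurrence:
  assumes lat: "lattice_in_SL2R \<Gamma>" and W: "open W" "mat 1 \<in> W"
    and g: "\<And>n::nat. g n \<in> carrier SL2R"
  obtains i j v w where "i < j" "v \<in> W" "w \<in> W" "det v = 1" "det w = 1"
    "w ** g j ** inv\<^bsub>SL2R\<^esub> (g i) ** inv\<^bsub>SL2R\<^esub> v \<in> \<Gamma>"
proof -
  interpret SL: group SL2R by (rule group_SL2R)
  have sub: "subgroup \<Gamma> SL2R" using lat by (simp add: lattice_in_SL2R_def)
  obtain M where M: "sets M = sets (borel_algebra (quotient_topology \<Gamma>))" "finite_measure M"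
    "emeasure M (space M) \<noteq> 0"
    "\<And>g A. g \<in> carrier SL2R \<Longrightarrow> A \<in> sets M \<Longrightarrow> emeasure M ((\<lambda>C. C #>\<^bsub>SL2R\<^esub> g) ` A) = emeasure M A"
    using lat unfolding lattice_in_SL2R_def by blast
  have \<Gamma>c: "\<Gamma> \<subseteq> carrier SL2R" by (rule subgroup.subset[OF sub])
  define B where "B = (\<lambda>h. {\<Gamma> #>\<^bsub>SL2R\<^esub> (v \<otimes>\<^bsub>SL2R\<^esub> h) | v. v \<in> W \<and> v \<in> carrier SL2R})"
  let ?X = "rcosets\<^bsub>SL2R\<^esub> \<Gamma>"
  have B_open: "openin (quotient_topology \<Gamma>) (B h)" if h: "h \<in> carrier SL2R" for h
  proof -
    define U where "U = (\<Union>\<gamma>\<in>\<Gamma>. {x. inv\<^bsub>SL2R\<^esub> \<gamma> ** x ** inv\<^bsub>SL2R\<^esub> h \<in> W})"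
    have "open {x. inv\<^bsub>SL2R\<^esub> \<gamma> ** x ** inv\<^bsub>SL2R\<^esub> h \<in> W}" for \<gamma>
    proof -
      have "continuous_on UNIV (\<lambda>x. inv\<^bsub>SL2R\<^esub> \<gamma> ** x ** inv\<^bsub>SL2R\<^esub> h)"
        by (rule continuous_on_compose2[OF continuous_matrix_mult_right continuous_matrix_mult_left]) simp
      from open_vimage[OF W(1) this] show ?thesis by (simp add: vimage_def)
    qed
    then have "open U" unfolding U_def by blast
    moreover have "\<Union>(B h) = carrier SL2R \<inter> U"
    proof
      show "\<Union>(B h) \<subseteq> carrier SL2R \<inter> U"
      proof
        fix x assume "x \<in> \<Union>(B h)"
        then obtain v \<gamma> where v: "v \<in> W" "v \<in> carrier SL2R" and \<gamma>: "\<gamma> \<in> \<Gamma>"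
          and x: "x = \<gamma> \<otimes>\<^bsub>SL2R\<^esub> (v \<otimes>\<^bsub>SL2R\<^esub> h)"
          unfolding B_def r_coset_def by blast
        have \<gamma>c: "\<gamma> \<in> carrier SL2R" using \<gamma> \<Gamma>c by blast
        have "inv\<^bsub>SL2R\<^esub> \<gamma> \<otimes>\<^bsub>SL2R\<^esub> x \<otimes>\<^bsub>SL2R\<^esub> inv\<^bsub>SL2R\<^esub> h = v"
          unfolding x using \<gamma>c v(2) h
          by (metis SL.inv_closed SL.inv_solve_left SL.inv_solve_right SL.m_closed)
        then have "inv\<^bsub>SL2R\<^esub> \<gamma> ** x ** inv\<^bsub>SL2R\<^esub> h \<in> W" using v(1) by simp
        moreover have "x \<in> carrier SL2R" unfolding x using \<gamma>c v(2) h SL.m_closed by blast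
        ultimately show "x \<in> carrier SL2R \<inter> U" unfolding U_def using \<gamma> by blast
      qed
      show "carrier SL2R \<inter> U \<subseteq> \<Union>(B h)"
      proof
        fix x assume "x \<in> carrier SL2R \<inter> U"
        then obtain \<gamma> where x: "x \<in> carrier SL2R" and \<gamma>: "\<gamma> \<in> \<Gamma>"
          and W: "inv\<^bsub>SL2R\<^esub> \<gamma> ** x ** inv\<^bsub>SL2R\<^esub> h \<in> W" unfolding U_def by blast
        have \<gamma>c: "\<gamma> \<in> carrier SL2R" using \<gamma> \<Gamma>c by blast
        define v where "v = inv\<^bsub>SL2R\<^esub> \<gamma> \<otimes>\<^bsub>SL2R\<^esub> x \<otimes>\<^bsub>SL2R\<^esub> inv\<^bsub>SL2R\<^esub> h"
        have v: "v \<in> W" "v \<in> carrier SL2R"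
          using W \<gamma>c x h SL.inv_closed SL.m_closed by (simp add: v_def, unfold v_def, blast)
        have "x = \<gamma> \<otimes>\<^bsub>SL2R\<^esub> (v \<otimes>\<^bsub>SL2R\<^esub> h)"
          unfolding v_def using \<gamma>c x h
          by (metis SL.inv_closed SL.inv_solve_left SL.inv_solve_right SL.m_closed)
        then show "x \<in> \<Union>(B h)" unfolding B_def r_coset_def using \<gamma> v by blast
      qed
    qed
    moreover have "B h \<subseteq> ?X" unfolding B_def using \<Gamma>c h SL.m_closed by (auto intro!: SL.rcosetsI simp del: SL2R_simps)
    ultimately show ?thesis
      unfolding openin_quotient_topology[OF sub] openin_open by blast
  qed
  have top: "topspace (quotient_topology \<Gamma>) \<subseteq> ?X"
    using openin_topspace[of "quotient_topology \<Gamma>"] openin_quotient_topology[OF sub] by blast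
  have space: "space M \<subseteq> ?X"
    using sets_eq_imp_space_eq[OF M(1)] top by simp
  have B_sets: "B h \<in> sets M" if "h \<in> carrier SL2R" for h
  proof -
    have "{U. openin (quotient_topology \<Gamma>) U} \<subseteq> Pow (topspace (quotient_topology \<Gamma>))"
      using openin_subset by blast
    then show ?thesis
      unfolding M(1) borel_algebra_def using B_open[OF that] by (simp add: sigma_sets.Basic)
  qed
  have B_eq: "(\<lambda>C. C #>\<^bsub>SL2R\<^esub> h) ` B (mat 1) = B h" if h: "h \<in> carrier SL2R" for h
  proof -
    have "(\<Gamma> #>\<^bsub>SL2R\<^esub> (v \<otimes>\<^bsub>SL2R\<^esub> mat 1)) #>\<^bsub>SL2R\<^esub> h = \<Gamma> #>\<^bsub>SL2R\<^esub> (v \<otimes>\<^bsub>SL2R\<^esub> h)" if "v \<in> carrier SL2R" for v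
      using SL.coset_mult_assoc[OF \<Gamma>c that h] by simp
    then show ?thesis unfolding B_def by (auto simp: image_iff simp del: SL2R_simps)
  qed
  have one: "mat 1 \<in> carrier SL2R" by simp
  define c where "c = emeasure M (B (mat 1))"
  have meas: "emeasure M (B h) = c" if "h \<in> carrier SL2R" for h
    using M(4)[OF that B_sets[OF one]] B_eq[OF that] by (simp add: c_def)
  have c0: "c \<noteq> 0"
  proof
    assume c: "c = 0"
    define V where "V = (\<lambda>h. {x. x ** inv\<^bsub>SL2R\<^esub> h \<in> W})"
    have "open (V h)" for h
      unfolding V_def using open_vimage[OF W(1) continuous_matrix_mult_right] by (simp add: vimage_def)
    then have opn: "\<And>S. S \<in> V ` carrier SL2R \<Longrightarrow> open S" by blast
    obtain F' where F': "F' \<subseteq> V ` carrier SL2R" "countable F'" "\<Union>F' = \<Union>(V ` carrier SL2R)"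
      by (rule Lindelof[OF opn])
    then have "\<exists>J. countable J \<and> J \<subseteq> carrier SL2R \<and> F' = V ` J"
      using countable_subset_image[of F' V "carrier SL2R"] by (simp del: SL2R_simps)
    then obtain J where J: "J \<subseteq> carrier SL2R" "countable J" "F' = V ` J"
      by (elim exE conjE)
    have "?X \<subseteq> (\<Union>h\<in>J. B h)"
    proof
      fix C assume "C \<in> ?X"
      then obtain x where x: "x \<in> carrier SL2R" "C = \<Gamma> #>\<^bsub>SL2R\<^esub> x" unfolding RCOSETS_def by blast
      have "x \<in> V x" using SL.r_inv[OF x(1)] W(2) by (simp add: V_def)
      then obtain h where h: "h \<in> J" "x \<in> V h" using F'(3) x(1) J(3) by blast
      have hc: "h \<in> carrier SL2R" using h J by blast
      have eq: "x = (x \<otimes>\<^bsub>SL2R\<^esub> inv\<^bsub>SL2R\<^esub> h) \<otimes>\<^bsub>SL2R\<^esub> h"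
        using SL.m_assoc[OF x(1) SL.inv_closed[OF hc] hc] SL.l_inv[OF hc] SL.r_one[OF x(1)] by simp
      have "x \<otimes>\<^bsub>SL2R\<^esub> inv\<^bsub>SL2R\<^esub> h \<in> W" using h(2) by (simp add: V_def)
      moreover have "x \<otimes>\<^bsub>SL2R\<^esub> inv\<^bsub>SL2R\<^esub> h \<in> carrier SL2R" using x(1) hc by (rule SL.m_closed[OF _ SL.inv_closed])
      ultimately have "C \<in> B h" unfolding B_def x(2)
        by (intro CollectI exI[of _ "x \<otimes>\<^bsub>SL2R\<^esub> inv\<^bsub>SL2R\<^esub> h"] conjI arg_cong[OF eq])
      then show "C \<in> (\<Union>h\<in>J. B h)" using h by blast
    qed
    then have "emeasure M (space M) \<le> emeasure M (\<Union>h\<in>J. B h)"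
      using space J B_sets by (intro emeasure_mono sets.countable_UN') auto
    also have "\<dots> = 0"
    proof (rule null_setsD1[OF null_sets_UN'[OF J(2)]])
      fix h assume "h \<in> J"
      then have h: "h \<in> carrier SL2R" using J(1) by blast
      show "B h \<in> null_sets M" by (rule null_setsI[OF _ B_sets[OF h]]) (simp only: meas[OF h] c)
    qed
    finally show False using M(3) by simp
  qed
  \<comment> \<open>Infinitely many disjoint sets of the same positive measure do not fit into a finite measure.\<close>
  have "\<exists>i j. i < j \<and> B (g i) \<inter> B (g j) \<noteq> {}"
  proof (rule ccontr)
    assume *: "\<not> ?thesis"
    have disj: "disjoint_family (\<lambda>i. B (g i))"
      unfolding disjoint_family_on_def using * by (metis Int_commute nat_neq_iff)
    have "(\<lambda>i. measure M (B (g i))) sums measure M (\<Union>i. B (g i))"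
      by (rule finite_measure.finite_measure_UNION[OF M(2) _ disj]) (use B_sets g in blast)
    moreover have "measure M (B (g i)) = enn2real c" for i
      unfolding measure_def by (simp only: meas[OF g])
    ultimately have "summable (\<lambda>i::nat. enn2real c)" by (simp add: sums_iff)
    then have "enn2real c = 0" by (simp only: summable_const_iff)
    moreover have "c \<noteq> \<infinity>" unfolding c_def by (rule finite_measure.emeasure_finite[OF M(2), unfolded infinity_ennreal_def[symmetric]])
    ultimately show False using c0 by (simp only: enn2real_eq_0_iff infinity_ennreal_def) blast
  qed
  then obtain i j where ij: "i < j" "B (g i) \<inter> B (g j) \<noteq> {}" by blast
  then obtain C where C: "C \<in> B (g i)" "C \<in> B (g j)" by blast
  obtain v where v: "v \<in> W" "v \<in> carrier SL2R" "C = \<Gamma> #>\<^bsub>SL2R\<^esub> (v \<otimes>\<^bsub>SL2R\<^esub> g i)"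
    using C(1) unfolding B_def by (elim CollectE exE conjE) (rule that)
  obtain w where w: "w \<in> W" "w \<in> carrier SL2R" "C = \<Gamma> #>\<^bsub>SL2R\<^esub> (w \<otimes>\<^bsub>SL2R\<^esub> g j)"
    using C(2) unfolding B_def by (elim CollectE exE conjE) (rule that)
  note vw = v(1,2) w(1,2) trans[OF v(3)[symmetric] w(3)]
  have car: "w \<otimes>\<^bsub>SL2R\<^esub> g j \<in> carrier SL2R" "v \<otimes>\<^bsub>SL2R\<^esub> g i \<in> carrier SL2R"
    by (rule SL.m_closed[OF vw(4) g], rule SL.m_closed[OF vw(2) g])
  have "w \<otimes>\<^bsub>SL2R\<^esub> g j \<in> \<Gamma> #>\<^bsub>SL2R\<^esub> (v \<otimes>\<^bsub>SL2R\<^esub> g i)"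
    unfolding vw(5) by (rule SL.rcos_self[OF car(1) sub])
  then have "(w \<otimes>\<^bsub>SL2R\<^esub> g j) \<otimes>\<^bsub>SL2R\<^esub> inv\<^bsub>SL2R\<^esub> (v \<otimes>\<^bsub>SL2R\<^esub> g i) \<in> \<Gamma>"
    by (rule subgroup.rcos_module_imp[OF sub group_SL2R car(2)])
  also have "(w \<otimes>\<^bsub>SL2R\<^esub> g j) \<otimes>\<^bsub>SL2R\<^esub> inv\<^bsub>SL2R\<^esub> (v \<otimes>\<^bsub>SL2R\<^esub> g i) = w ** g j ** inv\<^bsub>SL2R\<^esub> (g i) ** inv\<^bsub>SL2R\<^esub> v"
    unfolding SL.inv_mult_group[OF vw(2) g] by (simp add: matrix_mul_assoc)
  finally show thesis using that[OF ij(1) vw(1,3)] vw by simp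
qed

text \<open>
  Recurrence for the translations along the geodesic from \<open>- \<zeta>\<close> to \<open>\<zeta>\<close> gives \<open>\<gamma> = w h u\<close> with \<open>h\<close> a long
  translation towards \<open>\<zeta>\<close> and \<open>u\<close>, \<open>w\<close> close to \<open>1\<close>: the point \<open>u 0\<close> is close to \<open>0\<close>, \<open>h\<close> moves it close
  to \<open>\<zeta>\<close>, and \<open>w\<close> keeps it there.
\<close>
lemma orbit_dense_at_boundary:
  assumes lat: "lattice_in_SL2R \<Gamma>" and \<zeta>: "cmod \<zeta> = 1" and \<epsilon>: "\<epsilon> > 0"
  shows "\<exists>\<gamma>\<in>\<Gamma>. cmod (mob \<gamma> 0 - \<zeta>) < \<epsilon>"
proof -
  define \<eta> where "\<eta> = min (1/4) (\<epsilon> / 32)"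
  have \<eta>: "\<eta> > 0" "\<eta> \<le> 1/4" "\<eta> \<le> \<epsilon> / 32" using \<epsilon> by (auto simp: \<eta>_def)
  define W where "W = {A. cmod (alpha A - 1) < \<eta> \<and> cmod (beta A) < \<eta>}"
  have "continuous_on UNIV alpha" "continuous_on UNIV beta"
    unfolding alpha_def[abs_def] beta_def[abs_def] Complex_eq by (auto intro!: continuous_intros)
  then have "open W" unfolding W_def
    by (intro open_Collect_conj open_Collect_less continuous_intros)
  have "mat 1 \<in> W" using \<eta> by (simp add: W_def)
  obtain s where s: "s > 0" "exp (- s) < \<eta>"
  proof
    show "1 - ln \<eta> > 0" using \<eta> ln_le_minus_one[of \<eta>] by linarith
    have "exp (- (1 - ln \<eta>)) = exp (ln \<eta> + (-1))" by simp
    also have "\<dots> = \<eta> * exp (-1)" unfolding exp_add using \<eta>(1) by (simp only: exp_ln)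
    also have "\<dots> < \<eta> * 1" using \<eta> by (intro mult_strict_left_mono) auto
    finally show "exp (- (1 - ln \<eta>)) < \<eta>" by simp
  qed
  define g where "g = (\<lambda>i::nat. su11_matrix (of_real (cosh (real i * s))) (\<zeta> * of_real (sinh (real i * s))))"
  have ag: "alpha (g i) = of_real (cosh (real i * s))" "beta (g i) = \<zeta> * of_real (sinh (real i * s))" for i
    by (simp_all add: g_def)
  have gc: "g i \<in> carrier SL2R" for i
    by (simp add: det_eq_alpha_beta ag norm_mult \<zeta> cosh_square_eq power_mult_distrib)
  obtain i j v w where ij: "i < j" and W: "v \<in> W" "w \<in> W" and det: "det v = 1" "det w = 1"
    and \<gamma>: "w ** g j ** inv\<^bsub>SL2R\<^esub> (g i) ** inv\<^bsub>SL2R\<^esub> v \<in> \<Gamma>"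
    by (rule lattice_recurrence[OF lat \<open>open W\<close> \<open>mat 1 \<in> W\<close> gc])
  define T where "T = real j * s - real i * s"
  have T: "T \<ge> s" using ij s(1) mult_right_mono[of 1 "real j - real i" s] by (simp add: T_def left_diff_distrib)
  define h where "h = g j ** inv\<^bsub>SL2R\<^esub> (g i)"
  have zz: "\<zeta> * cnj \<zeta> = 1" using \<zeta> by (simp flip: complex_norm_square)
  have ah: "alpha h = of_real (cosh T)" "beta h = \<zeta> * of_real (sinh T)"
  proof -
    have d: "det (g i) = 1" using gc by simp
    show "alpha h = of_real (cosh T)"
      unfolding h_def alpha_mult alpha_beta_SL2R_inv[OF d] ag T_def cosh_diff
      using zz by (simp add: algebra_simps)
    show "beta h = \<zeta> * of_real (sinh T)"
      unfolding h_def beta_mult alpha_beta_SL2R_inv[OF d] ag T_def sinh_diff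
      by (simp add: algebra_simps)
  qed
  define u where "u = inv\<^bsub>SL2R\<^esub> v"
  have u: "cmod (cnj (alpha u) - 1) < \<eta>" "cmod (beta u) < \<eta>"
    using W(1) det(1) by (simp_all add: u_def alpha_beta_SL2R_inv W_def)
  have w: "cmod (alpha w - 1) < \<eta>" "cmod (beta w) < \<eta>" using W(2) by (simp_all add: W_def)
  define k where "k = h ** u"
  have detk: "det k = 1"
    unfolding k_def h_def u_def det_mul using gc det(1) group.inv_closed[OF group_SL2R] by simp
  \<comment> \<open>The row vector \<open>(1, - \<zeta>)\<close> is an eigenvector of \<open>h\<close> for the contracting eigenvalue \<open>exp (- T)\<close>.\<close>
  have kk: "beta k - \<zeta> * cnj (alpha k) = of_real (exp (- T)) * (beta u - \<zeta> * cnj (alpha u))"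
  proof -
    have "beta k - \<zeta> * cnj (alpha k) = of_real (cosh T - sinh T) * (beta u - \<zeta> * cnj (alpha u))"
      unfolding k_def beta_mult alpha_mult ah using zz by (simp add: algebra_simps)
    then show ?thesis by (simp add: cosh_minus_sinh)
  qed
  have "cmod (cnj (alpha u)) \<le> 1 + \<eta>" using u(1) norm_triangle_ineq2[of "cnj (alpha u)" 1] by simp
  then have "cmod (beta u - \<zeta> * cnj (alpha u)) \<le> 2"
    using norm_triangle_ineq4[of "beta u" "\<zeta> * cnj (alpha u)"] u(2) \<eta>(2) by (simp add: norm_mult \<zeta>)
  then have "cmod (beta k - \<zeta> * cnj (alpha k)) \<le> exp (- T) * 2"
    unfolding kk norm_mult by (intro mult_mono) auto
  moreover have "exp (- T) \<le> exp (- s)" using T by simp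
  ultimately have k1: "cmod (beta k - \<zeta> * cnj (alpha k)) \<le> 2 * \<eta>" using s(2) by linarith
  note abk = alpha_beta_norm[OF detk]
  define \<gamma> where "\<gamma> = w ** k"
  have mem: "\<gamma> \<in> \<Gamma>" using \<gamma> by (simp add: \<gamma>_def k_def h_def u_def matrix_mul_assoc)
  let ?a = "cmod (alpha k)"
  have aw: "cmod (alpha w) \<ge> 1 - \<eta>" "cmod (alpha w) \<le> 1 + \<eta>" "cmod (alpha w - cnj (alpha w)) \<le> 2 * \<eta>"
  proof -
    show "cmod (alpha w) \<ge> 1 - \<eta>" using norm_triangle_ineq2[of 1 "alpha w"] w(1) by (simp add: norm_minus_commute)
    show "cmod (alpha w) \<le> 1 + \<eta>" using norm_triangle_ineq2[of "alpha w" 1] w(1) by simp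
    have "cmod (cnj (alpha w - 1)) < \<eta>" unfolding complex_mod_cnj by (rule w(1))
    then show "cmod (alpha w - cnj (alpha w)) \<le> 2 * \<eta>"
      using norm_triangle_ineq4[of "alpha w - 1" "cnj (alpha w - 1)"] w(1) by simp
  qed
  have num: "beta \<gamma> - \<zeta> * cnj (alpha \<gamma>) = alpha w * (beta k - \<zeta> * cnj (alpha k))
      + \<zeta> * (alpha w - cnj (alpha w)) * cnj (alpha k) + beta w * cnj (alpha k) - \<zeta> * cnj (beta w) * beta k"
    by (simp add: \<gamma>_def alpha_mult beta_mult algebra_simps)
  have n1: "cmod (alpha w * (beta k - \<zeta> * cnj (alpha k))) \<le> 2 * (2 * \<eta>) * ?a"
  proof -
    have "cmod (alpha w * (beta k - \<zeta> * cnj (alpha k))) \<le> 2 * (2 * \<eta>)"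
      unfolding norm_mult using aw(2) \<eta> k1 by (intro mult_mono) auto
    also have "\<dots> \<le> 2 * (2 * \<eta>) * ?a" using abk(3) \<eta> mult_left_mono[of 1 ?a "2 * (2 * \<eta>)"] by simp
    finally show ?thesis .
  qed
  have n2: "cmod (\<zeta> * (alpha w - cnj (alpha w)) * cnj (alpha k)) \<le> 2 * \<eta> * ?a"
    unfolding norm_mult \<zeta> complex_mod_cnj mult_1 by (intro mult_right_mono aw) auto
  have n3: "cmod (beta w * cnj (alpha k)) \<le> \<eta> * ?a"
    unfolding norm_mult complex_mod_cnj using w by (intro mult_right_mono) auto
  have n4: "cmod (\<zeta> * cnj (beta w) * beta k) \<le> \<eta> * ?a"
    unfolding norm_mult \<zeta> complex_mod_cnj mult_1 using w abk(2) \<eta>(1) by (intro mult_mono) auto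
  have "cmod (beta \<gamma> - \<zeta> * cnj (alpha \<gamma>)) \<le> 2 * (2 * \<eta>) * ?a + 2 * \<eta> * ?a + \<eta> * ?a + \<eta> * ?a"
    unfolding num
    by (intro order_trans[OF norm_triangle_ineq4] order_trans[OF norm_triangle_ineq] add_mono n1 n2 n3 n4)
  then have top: "cmod (beta \<gamma> - \<zeta> * cnj (alpha \<gamma>)) \<le> 8 * \<eta> * ?a" by simp
  have "cmod (alpha \<gamma>) \<ge> cmod (alpha w) * ?a - cmod (beta w) * cmod (beta k)"
    using norm_triangle_ineq2[of "alpha w * alpha k" "- (beta w * cnj (beta k))"]
    by (simp add: \<gamma>_def alpha_mult norm_mult)
  moreover have "cmod (beta w) * cmod (beta k) \<le> 1/4 * ?a" using w \<eta> abk(2) by (intro mult_mono) auto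
  moreover have "3/4 * ?a \<le> cmod (alpha w) * ?a" using aw(1) \<eta> by (intro mult_right_mono) auto
  ultimately have bot: "?a / 2 \<le> cmod (alpha \<gamma>)" by linarith
  have apos: "?a > 0" using abk(4) by simp
  then have \<gamma>pos: "cmod (alpha \<gamma>) > 0" using bot by linarith
  then have "mob \<gamma> 0 - \<zeta> = (beta \<gamma> - \<zeta> * cnj (alpha \<gamma>)) / cnj (alpha \<gamma>)"
    by (simp add: mob_def num_def aut_def field_simps)
  then have "cmod (mob \<gamma> 0 - \<zeta>) = cmod (beta \<gamma> - \<zeta> * cnj (alpha \<gamma>)) / cmod (alpha \<gamma>)"
    by (simp add: norm_divide)
  also have "\<dots> \<le> (8 * \<eta> * ?a) / (?a / 2)"
    using top bot apos \<eta> by (intro frac_le) auto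
  also have "\<dots> = 16 * \<eta>" using apos by simp
  also have "\<dots> < \<epsilon>" using \<eta> \<epsilon> by simp
  finally show ?thesis using mem by blast
qed

section \<open>The index bound for lattices\<close>

lemma stabilizer_root_of_unity:
  assumes Z: "subgroup Z SL2R" "finite Z" and Z0: "\<And>\<gamma>. \<gamma> \<in> Z \<Longrightarrow> beta \<gamma> = 0" and g: "\<gamma> \<in> Z"
  shows "alpha \<gamma> ^ card Z = 1"
proof -
  let ?Z = "SL2R\<lparr>carrier := Z\<rparr>"
  interpret Z: group ?Z using subgroup.subgroup_is_group[OF Z(1) group_SL2R] .
  have pow: "alpha (\<gamma> [^]\<^bsub>?Z\<^esub> k) = alpha \<gamma> ^ k \<and> \<gamma> [^]\<^bsub>?Z\<^esub> k \<in> Z" for k :: nat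
  proof (induction k)
    case 0
    then show ?case using subgroup.one_closed[OF Z(1)] by simp
  next
    case (Suc k)
    then have "\<gamma> [^]\<^bsub>?Z\<^esub> k \<otimes>\<^bsub>SL2R\<^esub> \<gamma> \<in> Z" using subgroup.m_closed[OF Z(1)] g by blast
    then show ?case using Suc Z0[of "\<gamma> [^]\<^bsub>?Z\<^esub> k"] by (simp add: alpha_mult)
  qed
  have "\<gamma> [^]\<^bsub>?Z\<^esub> order ?Z = mat 1" using Z.pow_order_eq_1[of \<gamma>] g Z(2) by simp
  then show ?thesis using pow[of "order ?Z"] by (simp add: order_def)
qed

text \<open>
  The weight \<open>n + 2\<close> is a large multiple of the order of the stabiliser of \<open>0\<close>. As a multiple, it
  makes \<open>alpha ^ (n + 2)\<close> trivial on the stabiliser. As it is large, the sum of \<open>|alpha| ^ -(n + 2)\<close> over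
  the other elements is less than \<open>1\<close>, since \<open>|alpha|\<close> is bounded away from \<open>1\<close> there.
\<close>
lemma lattice_index_bound:
  assumes lat: "lattice_in_SL2R \<Gamma>"
  obtains N :: nat where "N > 0"
    "\<And>\<Lambda> S. subgroup \<Lambda> SL2R \<Longrightarrow> \<Lambda> \<subseteq> \<Gamma> \<Longrightarrow> finite ((\<lambda>\<gamma>. \<Lambda> #>\<^bsub>SL2R\<^esub> \<gamma>) ` \<Gamma>) \<Longrightarrow>
       finite S \<Longrightarrow> S \<subseteq> \<Lambda> \<Longrightarrow> generate SL2R S = \<Lambda> \<Longrightarrow>
       card ((\<lambda>\<gamma>. \<Lambda> #>\<^bsub>SL2R\<^esub> \<gamma>) ` \<Gamma>) + N \<le> N * card S"
proof -
  have sub: "subgroup \<Gamma> SL2R" and disc: "discrete \<Gamma>" using lat by (auto simp: lattice_in_SL2R_def)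
  have ab: "(cmod (alpha \<gamma>))\<^sup>2 = 1 + (cmod (beta \<gamma>))\<^sup>2" "cmod (alpha \<gamma>) \<ge> 1" if "\<gamma> \<in> \<Gamma>" for \<gamma>
    using alpha_beta_norm(1,3)[of \<gamma>] subgroup.mem_carrier[OF sub that] by simp_all
  interpret p0: poincare_setting \<Gamma> 10
    by (rule poincare_setting.intro[OF sub summable_alpha_discrete[OF sub disc]])
  let ?Z = "p0.stab"
  have Z: "?Z = {\<gamma> \<in> \<Gamma>. beta \<gamma> = 0}" by (rule p0.stab_def)
  obtain C :: nat where C: "\<And>k. finite {\<gamma> \<in> \<Gamma>. height \<gamma> = k}"
    using discrete_subgroup_height_count[OF sub disc] by metis
  have fin2: "finite {\<gamma> \<in> \<Gamma>. cmod (alpha \<gamma>) \<le> 2}"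
  proof (rule finite_subset)
    show "{\<gamma> \<in> \<Gamma>. cmod (alpha \<gamma>) \<le> 2} \<subseteq> (\<Union>k\<le>2. {\<gamma> \<in> \<Gamma>. height \<gamma> = k})"
    proof clarify
      fix \<gamma> assume "\<gamma> \<in> \<Gamma>" "cmod (alpha \<gamma>) \<le> 2"
      then have "height \<gamma> \<le> 2" unfolding height_def by (simp add: ceiling_le_iff nat_le_iff)
      then show "\<gamma> \<in> (\<Union>k\<le>2. {\<gamma> \<in> \<Gamma>. height \<gamma> = k})" using \<open>\<gamma> \<in> \<Gamma>\<close> by auto
    qed
  qed (use C in auto)
  have finZ: "finite ?Z"
  proof (rule finite_subset[OF _ fin2])
    show "?Z \<subseteq> {\<gamma> \<in> \<Gamma>. cmod (alpha \<gamma>) \<le> 2}"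
    proof
      fix \<gamma> assume "\<gamma> \<in> ?Z"
      then have g: "\<gamma> \<in> \<Gamma>" "beta \<gamma> = 0" by (auto simp: Z)
      then have "cmod (alpha \<gamma>) = 1" using ab[OF g(1)] by (auto simp: power2_eq_1_iff)
      then show "\<gamma> \<in> {\<gamma> \<in> \<Gamma>. cmod (alpha \<gamma>) \<le> 2}" using g by simp
    qed
  qed
  have "mat 1 \<in> ?Z" using p0.one_\<Gamma> by (simp add: Z)
  then have cardZ: "card ?Z > 0" using finZ card_gt_0_iff by blast
  define A where "A = {\<gamma> \<in> \<Gamma> - ?Z. cmod (alpha \<gamma>) \<le> 2}"
  have finA: "finite A" using finite_subset[OF _ fin2] by (simp add: A_def subset_iff)
  define q where "q = Min (insert 2 ((\<lambda>\<gamma>. cmod (alpha \<gamma>)) ` A))"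
  have gt1: "cmod (alpha \<gamma>) > 1" if "\<gamma> \<in> \<Gamma> - ?Z" for \<gamma>
  proof -
    have "(cmod (beta \<gamma>))\<^sup>2 > 0" using that by (simp add: Z)
    then have "1\<^sup>2 < (cmod (alpha \<gamma>))\<^sup>2" unfolding one_power2 using ab(1)[of \<gamma>] that by simp
    then show ?thesis by (rule power2_less_imp_less) simp
  qed
  have q1: "q > 1"
  proof -
    have "q \<in> insert 2 ((\<lambda>\<gamma>. cmod (alpha \<gamma>)) ` A)" unfolding q_def using finA by (intro Min_in) auto
    then show ?thesis using gt1 by (auto simp: A_def)
  qed
  have qle: "q \<le> cmod (alpha \<gamma>)" if "\<gamma> \<in> \<Gamma> - ?Z" for \<gamma>
  proof (cases "\<gamma> \<in> A")
    case True
    then show ?thesis unfolding q_def using finA by (intro Min_le) auto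
  next
    case False
    then have "2 \<le> cmod (alpha \<gamma>)" using that by (simp add: A_def)
    moreover have "q \<le> 2" unfolding q_def using finA by (intro Min_le) auto
    ultimately show ?thesis by linarith
  qed
  define S0 where "S0 = (\<Sum>\<^sub>\<infinity>\<gamma>\<in>\<Gamma> - ?Z. 1 / cmod (alpha \<gamma>) ^ 10)"
  obtain m where m: "S0 < q ^ m" using real_arch_pow[OF q1] by blast
  define n where "n = card ?Z * (m + 12) - 2"
  have n2: "n + 2 = card ?Z * (m + 12)" and n10: "n \<ge> m + 10"
  proof -
    have "1 * (m + 12) \<le> card ?Z * (m + 12)" using cardZ by (intro mult_right_mono) auto
    then obtain d where "card ?Z * (m + 12) = m + 12 + d" unfolding le_iff_add by auto
    then show "n + 2 = card ?Z * (m + 12)" "n \<ge> m + 10" unfolding n_def by simp_all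
  qed
  have pow_le: "1 / cmod (alpha \<gamma>) ^ n \<le> 1 / cmod (alpha \<gamma>) ^ 10" if "\<gamma> \<in> \<Gamma>" for \<gamma>
  proof (rule divide_left_mono)
    show "cmod (alpha \<gamma>) ^ 10 \<le> cmod (alpha \<gamma>) ^ n" using n10 by (intro power_increasing ab that) auto
    have "cmod (alpha \<gamma>) > 0" using less_le_trans[OF zero_less_one ab(2)[OF that]] .
    then show "0 < cmod (alpha \<gamma>) ^ n * cmod (alpha \<gamma>) ^ 10" by simp
  qed simp
  have "(\<lambda>\<gamma>. 1 / cmod (alpha \<gamma>) ^ n) summable_on \<Gamma>"
    by (rule summable_on_comparison_test[OF p0.summable_alpha pow_le]) auto
  then interpret p: poincare_setting \<Gamma> n by (rule poincare_setting.intro[OF sub])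
  have root: "alpha \<gamma> ^ (n + 2) = 1" if "\<gamma> \<in> ?Z" for \<gamma>
  proof -
    have "alpha \<gamma> ^ card ?Z = 1"
      by (rule stabilizer_root_of_unity[OF p0.subgroup_stab finZ _ that]) (simp add: Z)
    then show ?thesis unfolding n2 power_mult by simp
  qed
  have small: "(\<Sum>\<^sub>\<infinity>\<gamma>\<in>\<Gamma> - ?Z. 1 / cmod (alpha \<gamma>) ^ (n + 2)) < 1"
  proof -
    have summ: "(\<lambda>\<gamma>. 1 / cmod (alpha \<gamma>) ^ 10 * (1 / q ^ m)) summable_on \<Gamma> - ?Z"
      by (intro summable_on_cmult_left summable_on_subset[OF p0.summable_alpha]) auto
    have le: "1 / cmod (alpha \<gamma>) ^ (n + 2) \<le> 1 / cmod (alpha \<gamma>) ^ 10 * (1 / q ^ m)" if g: "\<gamma> \<in> \<Gamma> - ?Z" for \<gamma>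
    proof -
      let ?a = "cmod (alpha \<gamma>)"
      have "?a ^ 10 * q ^ m \<le> ?a ^ 10 * ?a ^ m"
        using qle[OF g] q1 by (intro mult_left_mono power_mono) auto
      also have "\<dots> = ?a ^ (10 + m)" by (simp only: power_add)
      also have "\<dots> \<le> ?a ^ (n + 2)" using n10 gt1[OF g] by (intro power_increasing) auto
      finally have "?a ^ 10 * q ^ m \<le> ?a ^ (n + 2)" .
      moreover have "0 < ?a ^ 10 * q ^ m" using gt1[OF g] q1 by (intro mult_pos_pos zero_less_power) auto
      ultimately have "1 / ?a ^ (n + 2) \<le> 1 / (?a ^ 10 * q ^ m)" by (rule frac_le[OF zero_le_one order_refl, rotated])
      then show ?thesis by simp
    qed
    have "(\<Sum>\<^sub>\<infinity>\<gamma>\<in>\<Gamma> - ?Z. 1 / cmod (alpha \<gamma>) ^ (n + 2)) \<le> (\<Sum>\<^sub>\<infinity>\<gamma>\<in>\<Gamma> - ?Z. 1 / cmod (alpha \<gamma>) ^ 10 * (1 / q ^ m))"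
      by (rule infsum_mono[OF summable_on_comparison_test[OF summ le] summ le]) auto
    also have "\<dots> = S0 * (1 / q ^ m)" unfolding S0_def by (rule infsum_cmult_left')
    also have "\<dots> < 1" using m q1 by simp
    finally show ?thesis .
  qed
  show thesis
  proof (rule that[of "card ?Z * Suc n"])
    show "card ?Z * Suc n > 0" using cardZ by simp
    fix \<Lambda> S assume *: "subgroup \<Lambda> SL2R" "\<Lambda> \<subseteq> \<Gamma>" "finite ((\<lambda>\<gamma>. \<Lambda> #>\<^bsub>SL2R\<^esub> \<gamma>) ` \<Gamma>)"
      "finite S" "S \<subseteq> \<Lambda>" "generate SL2R S = \<Lambda>"
    show "card ((\<lambda>\<gamma>. \<Lambda> #>\<^bsub>SL2R\<^esub> \<gamma>) ` \<Gamma>) + card ?Z * Suc n \<le> card ?Z * Suc n * card S"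
      by (rule p.index_le_generators[OF _ orbit_dense_at_boundary[OF lat] finZ root small *]) (use n10 in simp)
  qed
qed

section \<open>The rank gradient\<close>

lemma min_generators_cases:
  obtains "min_generators G = \<infinity>"
  | S where "finite S" "S \<subseteq> carrier G" "generate G S = carrier G" "min_generators G = enat (card S)"
proof (cases "{S. finite S \<and> S \<subseteq> carrier G \<and> generate G S = carrier G} = {}")
  case True
  show thesis by (rule that(1)) (simp add: min_generators_def True top_enat_def del: Collect_empty_eq)
next
  case False
  then have "min_generators G \<in> (\<lambda>S. enat (card S)) ` {S. finite S \<and> S \<subseteq> carrier G \<and> generate G S = carrier G}"
    unfolding min_generators_def by (blast intro: wellorder_InfI)
  then show thesis using that(2) by blast
qed

lemma min_generators_le:
  "finite S \<Longrightarrow> S \<subseteq> carrier G \<Longrightarrow> generate G S = carrier G \<Longrightarrow> min_generators G \<le> enat (card S)"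
  unfolding min_generators_def by (intro INF_lower) simp

definition gradient_term :: "('a, 'b) monoid_scheme \<Rightarrow> 'a set \<Rightarrow> ereal" where
  "gradient_term G K = (ereal_of_enat (min_generators (G\<lparr>carrier := K\<rparr>)) - 1) / ereal (real (subgroup_index G K))"

lemma gradient_term_infinite:
  assumes "min_generators (G\<lparr>carrier := K\<rparr>) = \<infinity>" "subgroup_index G K > 0"
  shows "gradient_term G K = \<infinity>"
  using assms by (simp add: gradient_term_def)

lemma gradient_term_finite:
  assumes "min_generators (G\<lparr>carrier := K\<rparr>) = enat d" "subgroup_index G K > 0"
  shows "gradient_term G K = ereal ((real d - 1) / real (subgroup_index G K))"
  using assms by (simp add: gradient_term_def one_ereal_def)

context group begin

lemma subgroup_index_pos:
  assumes "subgroup K G" "finite (rcosets K)"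
  shows "subgroup_index G K > 0"
  using subgroup.subgroup_in_rcosets[OF assms(1) is_group] assms(2) card_gt_0_iff
  unfolding subgroup_index_def by blast

text \<open>
  This is Schreier's bound for \<open>L\<close> in \<open>K\<close> after division by \<open>|G : L| = |G : K| |K : L|\<close>.
\<close>
lemma gradient_term_antimono:
  assumes K: "subgroup K G" "finite (rcosets K)" and L: "subgroup L G" "finite (rcosets L)" and LK: "L \<subseteq> K"
  shows "gradient_term G L \<le> gradient_term G K"
proof -
  let ?K = "G\<lparr>carrier := K\<rparr>"
  interpret K: group ?K using subgroup.subgroup_is_group[OF K(1) is_group] .
  note posK = subgroup_index_pos[OF K] and posL = subgroup_index_pos[OF L]
  have LinK: "subgroup L ?K" by (rule subgroup_incl[OF L(1) K(1) LK])
  have "rcosets\<^bsub>?K\<^esub> L \<subseteq> rcosets L"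
    unfolding RCOSETS_def using subgroup.subset[OF K(1)] by auto
  then have fin: "finite (rcosets\<^bsub>?K\<^esub> L)" using L(2) finite_subset by blast
  define q where "q = card (rcosets\<^bsub>?K\<^esub> L)"
  have idx: "subgroup_index G L = subgroup_index G K * q"
    using subgroup_index_mult[OF K(1) L(1) LK] by (simp add: q_def subgroup_index_def)
  show ?thesis
  proof (cases rule: min_generators_cases[of ?K])
    case 1
    then show ?thesis using gradient_term_infinite[OF 1 posK] by simp
  next
    case (2 S)
    obtain U where U: "finite U" "U \<subseteq> L" "generate ?K U = L" "card U + q \<le> q * card S + 1"
      using K.schreier_rank_bound[OF LinK fin 2(1-3)] unfolding q_def by blast
    have "generate (G\<lparr>carrier := L\<rparr>) U = L"
      using K.generate_consistent[OF U(2) LinK] U(3) by simp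
    then have "min_generators (G\<lparr>carrier := L\<rparr>) \<le> enat (card U)"
      using U by (intro min_generators_le) auto
    then obtain d where d: "min_generators (G\<lparr>carrier := L\<rparr>) = enat d" "d \<le> card U"
      by (cases "min_generators (G\<lparr>carrier := L\<rparr>)") auto
    have q0: "real q > 0" using posL idx by simp
    have "d + q \<le> q * card S + 1" using d U(4) by simp
    then have "real d + real q \<le> real q * real (card S) + 1"
      by (metis of_nat_1 of_nat_add of_nat_le_iff of_nat_mult)
    then have "real d - 1 \<le> real q * (real (card S) - 1)" by (simp add: right_diff_distrib)
    then have "(real d - 1) / real (subgroup_index G L) \<le> real q * (real (card S) - 1) / real (subgroup_index G L)"
      by (rule divide_right_mono) simp
    also have "\<dots> = (real (card S) - 1) / real (subgroup_index G K)" using q0 by (simp add: idx)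
    finally show ?thesis
      unfolding gradient_term_finite[OF d(1) posL] gradient_term_finite[OF 2(4) posK] by simp
  qed
qed

end

theorem mainTheorem7:
  fixes \<Gamma> :: "(real^2^2) set" and H :: "nat \<Rightarrow> (real^2^2) set"
  assumes "lattice_in_SL2R \<Gamma>"
    and "farber_chain (SL2R\<lparr>carrier := \<Gamma>\<rparr>) H"
  shows "rank_gradient (SL2R\<lparr>carrier := \<Gamma>\<rparr>) H > 0"
proof -
  let ?G = "SL2R\<lparr>carrier := \<Gamma>\<rparr>"
  have sub: "subgroup \<Gamma> SL2R" using assms(1) by (simp add: lattice_in_SL2R_def)
  interpret G: group ?G using subgroup.subgroup_is_group[OF sub group_SL2R] .
  have H: "subgroup (H n) ?G" "finite (rcosets\<^bsub>?G\<^esub> (H n))" "H (Suc n) \<subseteq> H n" for n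
    using assms(2) by (auto simp: farber_chain_def subgroup_chain_def)
  obtain N :: nat where N: "N > 0"
    "\<And>\<Lambda> S. subgroup \<Lambda> SL2R \<Longrightarrow> \<Lambda> \<subseteq> \<Gamma> \<Longrightarrow> finite ((\<lambda>\<gamma>. \<Lambda> #>\<^bsub>SL2R\<^esub> \<gamma>) ` \<Gamma>) \<Longrightarrow>
       finite S \<Longrightarrow> S \<subseteq> \<Lambda> \<Longrightarrow> generate SL2R S = \<Lambda> \<Longrightarrow>
       card ((\<lambda>\<gamma>. \<Lambda> #>\<^bsub>SL2R\<^esub> \<gamma>) ` \<Gamma>) + N \<le> N * card S"
    using lattice_index_bound[OF assms(1)] by metis
  define f where "f = (\<lambda>n. gradient_term ?G (H n))"
  have dec: "decseq f"
    unfolding f_def by (intro decseq_SucI G.gradient_term_antimono H)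
  have lower: "ereal (1 / real N) \<le> f n" for n
  proof -
    note pos = G.subgroup_index_pos[OF H(1,2), of n]
    have H\<Gamma>: "H n \<subseteq> \<Gamma>" using subgroup.subset[OF H(1)] by simp
    have Hsub: "subgroup (H n) SL2R"
      by (rule group.incl_subgroup[OF group_SL2R sub H(1)])
    have cos: "rcosets\<^bsub>?G\<^esub> (H n) = (\<lambda>\<gamma>. H n #>\<^bsub>SL2R\<^esub> \<gamma>) ` \<Gamma>"
      unfolding RCOSETS_def by auto
    show ?thesis
    proof (cases rule: min_generators_cases[of "?G\<lparr>carrier := H n\<rparr>"])
      case 1
      then show ?thesis unfolding f_def gradient_term_infinite[OF 1 pos] by simp
    next
      case (2 S)
      have S: "S \<subseteq> H n" using 2(2) by simp
      have "generate SL2R S = H n"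
        using group.generate_consistent[OF group_SL2R S Hsub] 2(3) by simp
      then have "subgroup_index ?G (H n) + N \<le> N * card S"
        using N(2)[OF Hsub H\<Gamma> _ 2(1) S] H(2)[of n] unfolding subgroup_index_def cos by blast
      then have "real (subgroup_index ?G (H n)) + real N \<le> real N * real (card S)"
        by (metis of_nat_add of_nat_le_iff of_nat_mult)
      then have "real (subgroup_index ?G (H n)) \<le> real N * (real (card S) - 1)"
        by (simp add: right_diff_distrib)
      then have "1 / real N \<le> (real (card S) - 1) / real (subgroup_index ?G (H n))"
        using N(1) pos by (simp add: field_simps)
      then show ?thesis unfolding f_def gradient_term_finite[OF 2(4) pos] by simp
    qed
  qed
  have "rank_gradient ?G H = lim f"
    unfolding rank_gradient_def f_def gradient_term_def ..
  also have "\<dots> = (INF n. f n)" by (rule limI[OF LIMSEQ_INF[OF dec]])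
  also have "\<dots> \<ge> ereal (1 / real N)" using lower by (rule INF_greatest)
  finally have "rank_gradient ?G H \<ge> ereal (1 / real N)" .
  moreover have "ereal (1 / real N) > 0" using N(1) by simp
  ultimately show ?thesis by (rule less_le_trans[rotated])
qed

end
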